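(* Let $K\subset\mathbb{R}^n$ be a convex body with the origin in its interior. For every real $p\ne-n$ and every invertible linear transformation $T:\mathbb{R}^n\to\mathbb{R}^n$, $$\tilde G_p(TK)=|\det(T)|^{\frac{n-p}{n+p}}\,\tilde G_p(K).$$
   Context: Fix an integer $n\ge1$. A convex body in $\mathbb{R}^n$ is a compact convex set with nonempty interior; $\mathcal{K}_0$ is the set of convex bodies containing the origin in their interior. For $K\in\mathcal{K}_0$, $K^\circ=\{y:\langle x,y\rangle\le1\ \forall x\in K\}$ is the polar body, $h_K(u)=\max_{x\in K}\langle x,u\rangle$ ($u\in S^{n-1}$) the support function, $|\cdot|$ is volume. $S(K,\cdot)$ is the surface area measure of $K$ on $S^{n-1}$: $S(K,A)$ is the $(n-1)$-dimensional Hausdorff measure of the set of $x\in\partial K$ at which $K$ has an outer unit normal in $A$. For $p\in\mathbb{R}$ and $K,Q\in\mathcal{K}_0$, $$V_p(K,Q)=\frac1n\int_{S^{n-1}}h_Q(u)^p\,h_K(u)^{1-p}\,dS(K,u).$$ The $L_p$ geominimal surface area of $K\in\mathcal{K}_0$ is $$\tilde G_p(K)=\inf_{Q\in\mathcal{K}_0}\Big\{n\,V_p(K,Q)^{\frac n{n+p}}|Q^\circ|^{\frac p{n+p}}\Big\}\ (p\ge0),\qquad \tilde G_p(K)=\sup_{Q\in\mathcal{K}_0}\Big\{n\,V_p(K,Q)^{\frac n{n+p}}|Q^\circ|^{\frac p{n+p}}\Big\}\ (-n\ne p<0),$$ the supremum being taken in $(0,+\infty]$. *)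

theory Defs
  imports "HOL-Analysis.Analysis"
begin

(* k-dimensional Hausdorff measure, normalized so that on k-dimensional Euclidean space it is
   Lebesgue measure.  Empty covering sets contribute 0 also for k = 0 (where 0 ^ 0 = 1), so that
   the 0-dimensional measure is counting measure.  Boundedness is required explicitly because
   the library's diameter of an unbounded set is unspecified. *)

definition hausdorff_weight :: "nat \<Rightarrow> 'a::metric_space set \<Rightarrow> real" where
  "hausdorff_weight k E = (if E = {} then 0 else unit_ball_vol (real k) * (diameter E / 2) ^ k)"

definition hausdorff_premeasure :: "nat \<Rightarrow> real \<Rightarrow> 'a::metric_space set \<Rightarrow> ennreal" where
  "hausdorff_premeasure k \<delta> A =
     (INF E \<in> {E :: nat \<Rightarrow> 'a set. A \<subseteq> (\<Union>i. E i) \<and> (\<forall>i. bounded (E i) \<and> diameter (E i) \<le> \<delta>)}.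
        (\<Sum>i. ennreal (hausdorff_weight k (E i))))"

definition hausdorff_measure :: "nat \<Rightarrow> 'a::metric_space set \<Rightarrow> ennreal" where
  "hausdorff_measure k A = (SUP \<delta> \<in> {0<..}. hausdorff_premeasure k \<delta> A)"

definition convex_body :: "(real^'n) set \<Rightarrow> bool" where
  "convex_body K \<longleftrightarrow> compact K \<and> convex K \<and> interior K \<noteq> {}"

definition bodies0 :: "(real^'n) set set" where
  "bodies0 = {K. convex_body K \<and> 0 \<in> interior K}"

definition polar_body :: "(real^'n) set \<Rightarrow> (real^'n) set" where
  "polar_body K = {y. \<forall>x\<in>K. x \<bullet> y \<le> 1}"

definition support_fun :: "(real^'n) set \<Rightarrow> real^'n \<Rightarrow> real" where
  "support_fun K u = (SUP x\<in>K. x \<bullet> u)"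

definition outer_unit_normal :: "(real^'n) set \<Rightarrow> real^'n \<Rightarrow> real^'n \<Rightarrow> bool" where
  "outer_unit_normal K x u \<longleftrightarrow> norm u = 1 \<and> (\<forall>y\<in>K. (y - x) \<bullet> u \<le> 0)"

(* The set function below is countably additive on the Borel sets of the sphere whenever K is a
   convex body (the boundary points with more than one outer unit normal form a null set), so
   measure_of does not fall back to the null measure. *)

definition surface_area_measure :: "(real^'n) set \<Rightarrow> (real^'n) measure" where
  "surface_area_measure K =
     measure_of (sphere 0 1) (sets (restrict_space borel (sphere 0 1)))
       (\<lambda>A. hausdorff_measure (CARD('n) - 1) {x \<in> frontier K. \<exists>u\<in>A. outer_unit_normal K x u})"

definition Lp_mixed_volume :: "real \<Rightarrow> (real^'n) set \<Rightarrow> (real^'n) set \<Rightarrow> real" where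
  "Lp_mixed_volume p K Q =
     1 / real CARD('n) *
       (LINT u|surface_area_measure K. support_fun Q u powr p * support_fun K u powr (1 - p))"

definition geominimal_functional :: "real \<Rightarrow> (real^'n) set \<Rightarrow> (real^'n) set \<Rightarrow> real" where
  "geominimal_functional p K Q =
     real CARD('n) * Lp_mixed_volume p K Q powr (real CARD('n) / (real CARD('n) + p))
       * measure lebesgue (polar_body Q) powr (p / (real CARD('n) + p))"

(* Values in [0, \<infinity>], since the supremum may be infinite; meaningful for p \<noteq> -n. *)

definition geominimal_surface_area :: "real \<Rightarrow> (real^'n) set \<Rightarrow> ennreal" where
  "geominimal_surface_area p K =
     (if p \<ge> 0 then (INF Q\<in>bodies0. ennreal (geominimal_functional p K Q))
      else (SUP Q\<in>bodies0. ennreal (geominimal_functional p K Q)))"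

end

(* With V_p(TK, TQ) = |det T| V_p(K, Q) and (TQ)^o = T^{-t} Q^o, the functional under the infimum or
   supremum scales by |det T|^((n-p)/(n+p)), and Q -> TQ permutes the bodies.  The formula for V_p rests
   on the transformation of the surface area measure: u is mapped to T^{-t} u / |T^{-t} u| and the area
   density is |det T| |T^{-t} u|.  It suffices to bound the area measure of TK by the transformed one of
   K, since the same bound for T^{-1} gives equality.  The bound is local: boundary points of K with
   normals near a form a nearly flat Lipschitz graph over the hyperplane orthogonal to a, so up to a
   factor close to 1 the Hausdorff measure may be computed after projecting to that hyperplane, where by
   translation invariance it is proportional to the Lebesgue volume of the prism of height 1 over a set. *)

theory Submission
  imports Defs
begin

text \<open>The encoding poses the first obstacle: \<open>measure_of\<close> yields the null measure
  unless its set function is countably additive, so boundary points with two normals must be shown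
  to be null before the surface area measure can be evaluated. Points with normals near two
  independent directions project, with Lipschitz inverse, to a subspace of codimension two; its area
  is 0 because the prism over it lies in a hyperplane. The ratio of area to prism volume is never
  computed. It cancels, because the image of a hyperplane under T is first rotated back onto that
  hyperplane. The bounds are one-sided and take values in \<open>ennreal\<close>, so that they also
  cover infinite values and projected boundary pieces whose measurability is not established. For a
  piece with normals within \<eta> of a, flattening costs a factor 1 / (1 - C^2 \<eta>) in lengths
  and freezing the density costs 1 + C^2 \<eta>, where C bounds T, its inverse transpose and the
  inverses of both. Both factors tend to 1, while for every \<eta> finitely many pieces cover the
  sphere.\<close>

lemma ennreal_mult_INF_le:
  fixes c x :: ennreal
  assumes "c \<noteq> 0" "c \<noteq> top" "\<And>i. i \<in> I \<Longrightarrow> x \<le> c * f i"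
  shows "x \<le> c * (INF i\<in>I. f i)"
proof -
  have "x / c \<le> (INF i\<in>I. f i)"
    using assms by (intro INF_greatest divide_le_posI_ennreal) (auto simp: zero_less_iff_neq_zero mult.commute)
  then have "x / c * c \<le> (INF i\<in>I. f i) * c"
    by (rule mult_right_mono) simp
  \<comment> \<open>Division undoes multiplication only for \<open>c\<close> different from 0 and
    top. Otherwise the claim fails: for \<open>c = top\<close> positive values \<open>f i\<close>
    may have infimum 0, and for \<open>c = 0\<close> the index set may be empty, with infimum
    top.\<close>
  moreover have "x / c * c = x"
    using assms by (simp add: ennreal_divide_times top.not_eq_extremum)
  ultimately show ?thesis
    by (simp add: mult.commute)
qed

subsection \<open>Hausdorff measure\<close>

lemma hausdorff_weight_nonneg: "bounded E \<Longrightarrow> 0 \<le> hausdorff_weight k E"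
  by (simp add: hausdorff_weight_def diameter_ge_0)

lemma hausdorff_weight_empty [simp]: "hausdorff_weight k {} = 0"
  by (simp add: hausdorff_weight_def)

lemma hausdorff_premeasure_le:
  assumes "A \<subseteq> (\<Union>i. E i)" "\<And>i. bounded (E i)" "\<And>i. diameter (E i) \<le> \<delta>"
  shows "hausdorff_premeasure k \<delta> A \<le> (\<Sum>i. ennreal (hausdorff_weight k (E i)))"
  unfolding hausdorff_premeasure_def using assms by (intro INF_lower) auto

lemma hausdorff_premeasure_mono:
  "A \<subseteq> B \<Longrightarrow> hausdorff_premeasure k \<delta> A \<le> hausdorff_premeasure k \<delta> B"
  unfolding hausdorff_premeasure_def by (intro INF_superset_mono) auto

lemma hausdorff_premeasure_antimono:
  "\<delta> \<le> \<delta>' \<Longrightarrow> hausdorff_premeasure k \<delta>' A \<le> hausdorff_premeasure k \<delta> A"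
  unfolding hausdorff_premeasure_def by (intro INF_superset_mono) (auto intro: order_trans)

lemma hausdorff_premeasure_countable_subadditive:
  fixes A :: "nat \<Rightarrow> 'a::metric_space set"
  shows "hausdorff_premeasure k \<delta> (\<Union>i. A i) \<le> (\<Sum>i. hausdorff_premeasure k \<delta> (A i))"
    (is "?O (\<Union>i. A i) \<le> _")
proof (rule ennreal_le_epsilon)
  fix e :: real assume "0 < e" and fin: "(\<Sum>n. ?O (A n)) < top"
  define \<epsilon> where "\<epsilon> n = e * (1 / 2) ^ Suc n" for n
  have "\<epsilon> n > 0" for n
    using \<open>0 < e\<close> by (simp add: \<epsilon>_def)
  have "\<epsilon> sums (e * 1)"
    unfolding \<epsilon>_def by (intro sums_mult power_half_series)
  then have sum_\<epsilon>: "(\<Sum>n. ennreal (\<epsilon> n)) = ennreal e"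
    using \<open>\<And>n. \<epsilon> n > 0\<close> by (intro suminf_ennreal_eq) (auto intro: less_imp_le)
  have "\<exists>E. A n \<subseteq> (\<Union>i. E i) \<and> (\<forall>i. bounded (E i) \<and> diameter (E i) \<le> \<delta>) \<and>
      (\<Sum>i. ennreal (hausdorff_weight k (E i))) < ?O (A n) + ennreal (\<epsilon> n)" for n
  proof -
    \<comment> \<open>Only below top is adding \<open>\<epsilon> n\<close> a strict increase, and
      strictness is what yields a cover beating that bound.\<close>
    have "?O (A n) < top"
      using ennreal_suminf_lessD[OF fin] .
    then have "?O (A n) < ?O (A n) + ennreal (\<epsilon> n)"
      using \<open>\<epsilon> n > 0\<close> by simp
    then show ?thesis
      unfolding hausdorff_premeasure_def INF_less_iff by auto
  qed
  then obtain E where E: "\<And>n. A n \<subseteq> (\<Union>i. E n i)" "\<And>n i. bounded (E n i)"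
      "\<And>n i. diameter (E n i) \<le> \<delta>"
      "\<And>n. (\<Sum>i. ennreal (hausdorff_weight k (E n i))) < ?O (A n) + ennreal (\<epsilon> n)"
    by metis
  define F where "F m = E (fst (prod_decode m)) (snd (prod_decode m))" for m
  have "(\<Union>n. A n) \<subseteq> (\<Union>m. F m)"
  proof
    fix x assume "x \<in> (\<Union>n. A n)"
    then obtain n i where "x \<in> E n i"
      using E(1) by blast
    then have "x \<in> F (prod_encode (n, i))"
      by (simp add: F_def)
    then show "x \<in> (\<Union>m. F m)"
      by blast
  qed
  then have "?O (\<Union>n. A n) \<le> (\<Sum>m. ennreal (hausdorff_weight k (F m)))"
    by (rule hausdorff_premeasure_le) (simp_all add: F_def E)
  also have "\<dots> = (\<Sum>n. \<Sum>i. ennreal (hausdorff_weight k (E n i)))"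
    unfolding F_def
    by (rule suminf_ennreal_2dimen[where f = "\<lambda>q. ennreal (hausdorff_weight k (E (fst q) (snd q)))"]) simp
  also have "\<dots> \<le> (\<Sum>n. ?O (A n) + ennreal (\<epsilon> n))"
    by (intro suminf_le less_imp_le[OF E(4)]) auto
  also have "\<dots> = (\<Sum>n. ?O (A n)) + ennreal e"
    by (subst suminf_add[symmetric]) (auto simp: sum_\<epsilon>)
  finally show "?O (\<Union>n. A n) \<le> (\<Sum>n. ?O (A n)) + ennreal e" .
qed

lemma hausdorff_premeasure_le_measure: "0 < \<delta> \<Longrightarrow> hausdorff_premeasure k \<delta> A \<le> hausdorff_measure k A"
  unfolding hausdorff_measure_def by (intro SUP_upper) auto

lemma hausdorff_measure_le:
  "(\<And>\<delta>. 0 < \<delta> \<Longrightarrow> hausdorff_premeasure k \<delta> A \<le> x) \<Longrightarrow> hausdorff_measure k A \<le> x"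
  unfolding hausdorff_measure_def by (intro SUP_least) auto

lemma hausdorff_measure_mono: "A \<subseteq> B \<Longrightarrow> hausdorff_measure k A \<le> hausdorff_measure k B"
  unfolding hausdorff_measure_def by (intro SUP_mono' hausdorff_premeasure_mono)

lemma hausdorff_measure_empty [simp]: "hausdorff_measure k {} = 0"
proof -
  have "hausdorff_premeasure k \<delta> {} \<le> 0" if "\<delta> > 0" for \<delta>
    using hausdorff_premeasure_le[of "{}" "\<lambda>_. {}" \<delta> k] that by auto
  then show ?thesis
    using hausdorff_measure_le[of k "{}" 0] by (metis le_zero_eq)
qed

lemma hausdorff_measure_countable_subadditive:
  "hausdorff_measure k (\<Union>i. A i) \<le> (\<Sum>i. hausdorff_measure k (A (i::nat)))"
proof (rule hausdorff_measure_le)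
  fix \<delta> :: real assume "0 < \<delta>"
  then have "(\<Sum>i. hausdorff_premeasure k \<delta> (A i)) \<le> (\<Sum>i. hausdorff_measure k (A i))"
    by (intro suminf_le hausdorff_premeasure_le_measure) auto
  then show "hausdorff_premeasure k \<delta> (\<Union>i. A i) \<le> (\<Sum>i. hausdorff_measure k (A i))"
    using hausdorff_premeasure_countable_subadditive order_trans by blast
qed

lemma outer_measure_space_hausdorff:
  "outer_measure_space UNIV (hausdorff_measure k :: 'a::metric_space set \<Rightarrow> _)"
  by (simp add: outer_measure_space_def positive_def increasing_def hausdorff_measure_mono
      countably_subadditive_def hausdorff_measure_countable_subadditive)

lemma hausdorff_measure_Un_le:
  "hausdorff_measure k (A \<union> B) \<le> hausdorff_measure k A + hausdorff_measure k B"
proof -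
  have "(\<Union>i. binaryset A B i) = A \<union> B"
    by (rule UN_binaryset_eq)
  moreover have "(\<Sum>i. hausdorff_measure k (binaryset A B i)) = hausdorff_measure k A + hausdorff_measure k B"
    by (intro suminf_binaryset_eq) auto
  ultimately show ?thesis
    by (metis hausdorff_measure_countable_subadditive)
qed

lemma hausdorff_measure_countable_null:
  assumes "countable I" "\<And>i. i \<in> I \<Longrightarrow> hausdorff_measure k (A i) = 0"
  shows "hausdorff_measure k (\<Union>i\<in>I. A i) = 0"
proof (cases "I = {}")
  case False
  have "hausdorff_measure k (\<Union>n. A (from_nat_into I n)) \<le> (\<Sum>n. hausdorff_measure k (A (from_nat_into I n)))"
    by (rule hausdorff_measure_countable_subadditive)
  also have "\<dots> = 0"
    using assms False by (simp add: from_nat_into)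
  finally show ?thesis
    using False assms(1) by (metis UN_from_nat_into le_zero_eq)
qed auto

text \<open>A cover of the image under \<open>g\<close> is pulled back to \<open>S\<close> and
  pushed forward by \<open>f\<close>, which multiplies diameters by at most \<open>L\<close>. The
  form with two maps expresses that a projection \<open>g\<close> has a Lipschitz inverse on
  \<open>S\<close> without naming that inverse.\<close>

lemma hausdorff_measure_image_le:
  fixes f :: "'c \<Rightarrow> 'a::metric_space" and g :: "'c \<Rightarrow> 'b::metric_space"
  assumes "L > 0" and dist: "\<And>x y. x \<in> S \<Longrightarrow> y \<in> S \<Longrightarrow> dist (f x) (f y) \<le> L * dist (g x) (g y)"
  shows "hausdorff_measure k (f ` S) \<le> ennreal (L ^ k) * hausdorff_measure k (g ` S)"
proof (rule hausdorff_measure_le)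
  fix \<delta> :: real assume "0 < \<delta>"
  have "hausdorff_premeasure k \<delta> (f ` S) \<le> ennreal (L ^ k) * hausdorff_premeasure k (\<delta> / L) (g ` S)"
    unfolding hausdorff_premeasure_def[of k "\<delta> / L"]
  proof (rule ennreal_mult_INF_le)
    fix E :: "nat \<Rightarrow> 'b set"
    assume "E \<in> {E. g ` S \<subseteq> \<Union> (range E) \<and> (\<forall>i. bounded (E i) \<and> diameter (E i) \<le> \<delta> / L)}"
    then have E: "g ` S \<subseteq> (\<Union>i. E i)" "\<And>i. bounded (E i)" "\<And>i. diameter (E i) \<le> \<delta> / L"
      by auto
    define F where "F i = f ` {x \<in> S. g x \<in> E i}" for i
    have d: "dist x y \<le> L * diameter (E i)" if xy: "x \<in> F i" "y \<in> F i" for i x y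
    proof -
      obtain a b where ab: "a \<in> S" "b \<in> S" "g a \<in> E i" "g b \<in> E i" "x = f a" "y = f b"
        using xy by (auto simp: F_def)
      have "L * dist (g a) (g b) \<le> L * diameter (E i)"
        using diameter_bounded_bound[OF E(2) ab(3,4)] \<open>L > 0\<close> by simp
      then show ?thesis
        using dist[OF ab(1,2)] by (simp add: ab(5,6))
    qed
    have bF: "bounded (F i)" for i
      using d[of _ i] by (force simp: bounded_two_points)
    have dF: "diameter (F i) \<le> L * diameter (E i)" for i
    proof (cases "F i = {}")
      case False
      then show ?thesis
        unfolding diameter_def[of "F i"] by (simp, intro cSUP_least) (auto intro!: d)
    qed (use \<open>L > 0\<close> E in \<open>auto intro!: mult_nonneg_nonneg diameter_ge_0\<close>)
    \<comment> \<open>An empty \<open>F i\<close> has weight 0 even for \<open>k = 0\<close>; a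
      nonempty one forces \<open>E i\<close> to be nonempty, and then both weights are given by the
      power formula.\<close>
    have wF: "hausdorff_weight k (F i) \<le> L ^ k * hausdorff_weight k (E i)" for i
    proof (cases "F i = {}")
      case False
      then have "E i \<noteq> {}"
        by (auto simp: F_def)
      have "(diameter (F i) / 2) ^ k \<le> (L * diameter (E i) / 2) ^ k"
        using dF[of i] bF[of i] by (intro power_mono) (auto simp: diameter_ge_0)
      then have "unit_ball_vol (real k) * (diameter (F i) / 2) ^ k \<le> unit_ball_vol (real k) * (L * diameter (E i) / 2) ^ k"
        by (intro mult_left_mono) auto
      also have "\<dots> = L ^ k * (unit_ball_vol (real k) * (diameter (E i) / 2) ^ k)"
        by (simp add: power_mult_distrib power_divide)
      finally show ?thesis
        using \<open>E i \<noteq> {}\<close> False by (simp add: hausdorff_weight_def)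
    qed (use E \<open>L > 0\<close> in \<open>auto simp: hausdorff_weight_nonneg\<close>)
    have "hausdorff_premeasure k \<delta> (f ` S) \<le> (\<Sum>i. ennreal (hausdorff_weight k (F i)))"
    proof (rule hausdorff_premeasure_le)
      show "f ` S \<subseteq> (\<Union>i. F i)"
        using E(1) by (fastforce simp: F_def)
      show "diameter (F i) \<le> \<delta>" for i
        using dF[of i] E(3)[of i] \<open>L > 0\<close> by (simp add: field_simps)
    qed (rule bF)
    also have "\<dots> \<le> (\<Sum>i. ennreal (L ^ k) * ennreal (hausdorff_weight k (E i)))"
      using wF \<open>L > 0\<close> by (intro suminf_le) (auto simp flip: ennreal_mult' intro!: ennreal_leI)
    finally show "hausdorff_premeasure k \<delta> (f ` S) \<le> ennreal (L ^ k) * (\<Sum>i. ennreal (hausdorff_weight k (E i)))"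
      by simp
  qed (use \<open>L > 0\<close> in auto)
  also have "\<dots> \<le> ennreal (L ^ k) * hausdorff_measure k (g ` S)"
    using \<open>0 < \<delta>\<close> \<open>L > 0\<close> by (intro mult_left_mono hausdorff_premeasure_le_measure) auto
  finally show "hausdorff_premeasure k \<delta> (f ` S) \<le> ennreal (L ^ k) * hausdorff_measure k (g ` S)" .
qed

lemma hausdorff_measure_isometry:
  assumes "\<And>x y. x \<in> S \<Longrightarrow> y \<in> S \<Longrightarrow> dist (f x) (f y) = dist x y"
  shows "hausdorff_measure k (f ` S) = hausdorff_measure k S"
  using hausdorff_measure_image_le[of 1 S f "\<lambda>x. x" k] hausdorff_measure_image_le[of 1 S "\<lambda>x. x" f k] assms
  by auto

section \<open>Caratheodory measurability of Borel sets\<close>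

lemma hausdorff_measure_Un_separated:
  fixes A B :: "'a::metric_space set"
  assumes "d > 0" and sep: "\<And>x y. x \<in> A \<Longrightarrow> y \<in> B \<Longrightarrow> d \<le> dist x y"
  shows "hausdorff_measure k A + hausdorff_measure k B \<le> hausdorff_measure k (A \<union> B)"
proof -
  \<comment> \<open>A covering set of diameter below \<open>d\<close> meets at most one of the two
    sets, so a fine cover of the union splits into covers of \<open>A\<close> and of
    \<open>B\<close> that share no set.\<close>
  have small: "hausdorff_premeasure k \<delta> A + hausdorff_premeasure k \<delta> B \<le> hausdorff_premeasure k \<delta> (A \<union> B)"
    if "\<delta> < d" for \<delta>
    unfolding hausdorff_premeasure_def[of k \<delta> "A \<union> B"]
  proof (rule INF_greatest)
    fix E :: "nat \<Rightarrow> 'a set"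
    assume "E \<in> {E. A \<union> B \<subseteq> \<Union> (range E) \<and> (\<forall>i. bounded (E i) \<and> diameter (E i) \<le> \<delta>)}"
    then have E: "A \<union> B \<subseteq> (\<Union>i. E i)" "\<And>i. bounded (E i)" "\<And>i. diameter (E i) \<le> \<delta>"
      by auto
    have "0 \<le> \<delta>"
      using E(2,3) diameter_ge_0 order_trans by blast
    define F where "F X i = (if E i \<inter> X = {} then {} else E i)" for X i
    have F: "hausdorff_premeasure k \<delta> X \<le> (\<Sum>i. ennreal (hausdorff_weight k (F X i)))"
      if X: "X \<subseteq> A \<union> B" for X
    proof (rule hausdorff_premeasure_le)
      show "X \<subseteq> (\<Union>i. F X i)"
      proof
        fix x assume "x \<in> X"
        then obtain i where "x \<in> E i"
          using X E(1) by blast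
        then show "x \<in> (\<Union>i. F X i)"
          using \<open>x \<in> X\<close> by (auto simp: F_def intro!: exI[of _ i])
      qed
    qed (use E \<open>0 \<le> \<delta>\<close> in \<open>auto simp: F_def\<close>)
    have "E i \<inter> A = {} \<or> E i \<inter> B = {}" for i
    proof (rule ccontr)
      assume "\<not> ?thesis"
      then obtain x y where "x \<in> E i" "x \<in> A" "y \<in> E i" "y \<in> B"
        by auto
      then show False
        using diameter_bounded_bound[OF E(2)[of i], of x y] E(3)[of i] sep[of x y] \<open>\<delta> < d\<close> by auto
    qed
    then have w: "ennreal (hausdorff_weight k (F A i)) + ennreal (hausdorff_weight k (F B i))
        \<le> ennreal (hausdorff_weight k (E i))" for i
      by (cases "E i \<inter> A = {}") (auto simp: F_def)
    have "hausdorff_premeasure k \<delta> A + hausdorff_premeasure k \<delta> B \<le>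
      (\<Sum>i. ennreal (hausdorff_weight k (F A i))) + (\<Sum>i. ennreal (hausdorff_weight k (F B i)))"
      by (intro add_mono F) auto
    also have "\<dots> = (\<Sum>i. ennreal (hausdorff_weight k (F A i)) + ennreal (hausdorff_weight k (F B i)))"
      by (intro suminf_add) auto
    also have "\<dots> \<le> (\<Sum>i. ennreal (hausdorff_weight k (E i)))"
      by (intro suminf_le w) auto
    finally show "hausdorff_premeasure k \<delta> A + hausdorff_premeasure k \<delta> B \<le> (\<Sum>i. ennreal (hausdorff_weight k (E i)))" .
  qed
  \<comment> \<open>Premeasures grow as \<delta> shrinks, so both suprema run along a common
    directed family and their sum is the supremum of the sums.\<close>
  have "hausdorff_measure k A + hausdorff_measure k B =
      (SUP \<delta>\<in>{0<..}. hausdorff_premeasure k \<delta> A + hausdorff_premeasure k \<delta> B)"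
    unfolding hausdorff_measure_def
  proof (rule SUP_add_directed_ennreal[symmetric])
    fix a b :: real assume "a \<in> {0<..}" "b \<in> {0<..}"
    then show "\<exists>c\<in>{0<..}. hausdorff_premeasure k a A + hausdorff_premeasure k b B
        \<le> hausdorff_premeasure k c A + hausdorff_premeasure k c B"
      by (intro bexI[of _ "min a b"] add_mono hausdorff_premeasure_antimono) auto
  qed
  also have "\<dots> \<le> hausdorff_measure k (A \<union> B)"
  proof (rule SUP_least)
    fix \<delta> :: real assume "\<delta> \<in> {0<..}"
    then have "hausdorff_premeasure k \<delta> A + hausdorff_premeasure k \<delta> B \<le>
       hausdorff_premeasure k (min \<delta> (d/2)) A + hausdorff_premeasure k (min \<delta> (d/2)) B"
      by (intro add_mono hausdorff_premeasure_antimono) auto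
    also have "\<dots> \<le> hausdorff_premeasure k (min \<delta> (d/2)) (A \<union> B)"
      using \<open>d > 0\<close> by (intro small) auto
    also have "\<dots> \<le> hausdorff_measure k (A \<union> B)"
      using \<open>\<delta> \<in> {0<..}\<close> \<open>d > 0\<close> by (intro hausdorff_premeasure_le_measure) auto
    finally show "hausdorff_premeasure k \<delta> A + hausdorff_premeasure k \<delta> B \<le> hausdorff_measure k (A \<union> B)" .
  qed
  finally show ?thesis .
qed

text \<open>Caratheodory's criterion for metric outer measures. Points of \<open>A\<close> at
  distance at least \<open>r i\<close> from \<open>C\<close> are separated from
  \<open>A \<inter> C\<close>, which gives the inequality with \<open>far i\<close> in place of
  \<open>A - C\<close>. The rest of \<open>A - C\<close> is cut into rings by distance to
  \<open>C\<close>. Rings of equal parity are separated from each other, so all ring measures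
  together sum to at most twice the measure of \<open>A\<close>, and the tail of the sum is
  negligible.\<close>

lemma hausdorff_measure_split_closed:
  fixes C :: "'a::metric_space set"
  assumes "closed C"
  shows "hausdorff_measure k (A \<inter> C) + hausdorff_measure k (A - C) \<le> hausdorff_measure k A"
\<comment> \<open>\<open>infdist\<close> to the empty set is 0 by convention, so an empty
  \<open>C\<close> is treated apart. Finite measure of \<open>A\<close> is what later makes the ring
  sum cancellable.\<close>
proof (cases "C = {} \<or> hausdorff_measure k A = top")
  case False
  let ?H = "hausdorff_measure k :: 'a set \<Rightarrow> ennreal"
  have "C \<noteq> {}" and finA: "?H A \<noteq> top"
    using False by auto
  define r where "r i = 1 / real (Suc i)" for i
  define far where "far i = {x \<in> A. r i \<le> infdist x C}" for i
  define ring where "ring i = {x \<in> A. r (Suc i) \<le> infdist x C \<and> infdist x C < r i}" for i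
  have infdist_diff: "infdist x C - infdist y C \<le> dist x y" for x y
    using infdist_triangle[of x C y] by simp
  have far: "?H (A \<inter> C) + ?H (far i) \<le> ?H A" for i
  proof -
    have "?H (far i) + ?H (A \<inter> C) \<le> ?H (far i \<union> (A \<inter> C))"
    proof (rule hausdorff_measure_Un_separated[of "r i"])
      fix x y assume "x \<in> far i" "y \<in> A \<inter> C"
      then show "r i \<le> dist x y"
        using infdist_diff[of x y] by (simp add: far_def)
    qed (simp add: r_def)
    also have "\<dots> \<le> ?H A"
      by (intro hausdorff_measure_mono) (auto simp: far_def)
    finally show ?thesis
      by (simp add: add.commute)
  qed
  have cover: "A - C \<subseteq> far i \<union> (\<Union>j. ring (j + i))" for i
  proof
    fix x assume x: "x \<in> A - C"
    show "x \<in> far i \<union> (\<Union>j. ring (j + i))"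
    proof (cases "x \<in> far i")
      case False
      then have lt: "infdist x C < r i"
        using x by (auto simp: far_def)
      have "infdist x C > 0"
        using x assms \<open>C \<noteq> {}\<close> in_closed_iff_infdist_zero[of C x] infdist_nonneg[of x C] by fastforce
      then obtain n where "r n < infdist x C"
        using reals_Archimedean[of "infdist x C"] by (auto simp: r_def inverse_eq_divide)
      then have ex: "\<exists>n. r n \<le> infdist x C"
        using less_imp_le by blast
      define n where "n = (LEAST n. r n \<le> infdist x C)"
      have n: "r n \<le> infdist x C"
        unfolding n_def using ex by (rule LeastI_ex)
      have "i < n"
      proof (rule ccontr)
        assume "\<not> i < n"
        then have "r i \<le> r n"
          by (auto simp: r_def field_simps)
        then show False
          using n lt by linarith
      qed
      then obtain j where j: "n = Suc (j + i)"
        using less_imp_Suc_add by (metis add.commute add_Suc)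
      have "\<not> r (j + i) \<le> infdist x C"
        using not_less_Least[of "j + i" "\<lambda>n. r n \<le> infdist x C"] j unfolding n_def by auto
      then have "x \<in> ring (j + i)"
        using x n j by (auto simp: ring_def)
      then show ?thesis
        by blast
    qed auto
  qed
  \<comment> \<open>Between two rings of one parity lies a ring of the other parity, and its
    thickness bounds their distance from below. In the case \<open>n = 0\<close> the union of
    earlier rings is empty; treating it apart also avoids the truncated difference
    \<open>s - 1\<close> at \<open>s = 0\<close>.\<close>
  have alternate: "(\<Sum>j<n. ?H (ring (2 * j + s))) \<le> ?H (\<Union>j<n. ring (2 * j + s))" for n s
  proof (induction n)
    case (Suc n)
    let ?d = "r (2 * n + s) - r (Suc (2 * n + s))"
    have "(\<Sum>j<Suc n. ?H (ring (2 * j + s))) \<le> ?H (\<Union>j<n. ring (2 * j + s)) + ?H (ring (2 * n + s))"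
      using Suc by (simp add: add_right_mono)
    also have "\<dots> = ?H (ring (2 * n + s)) + ?H (\<Union>j<n. ring (2 * j + s))"
      by (simp add: add.commute)
    also have "\<dots> \<le> ?H (ring (2 * n + s) \<union> (\<Union>j<n. ring (2 * j + s)))"
    proof (cases "n = 0")
      case False
      show ?thesis
      proof (rule hausdorff_measure_Un_separated[of "r (2 * n + s - 1) - r (2 * n + s)"])
        show "0 < r (2 * n + s - 1) - r (2 * n + s)"
          using False by (simp add: r_def frac_less2)
        fix x y assume "x \<in> ring (2 * n + s)" and "y \<in> (\<Union>j<n. ring (2 * j + s))"
        then obtain j where "j < n" and y: "r (Suc (2 * j + s)) \<le> infdist y C" and x: "infdist x C < r (2 * n + s)"
          by (auto simp: ring_def)
        have "r (2 * n + s - 1) \<le> r (Suc (2 * j + s))"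
          using \<open>j < n\<close> by (auto simp: r_def field_simps)
        then show "r (2 * n + s - 1) - r (2 * n + s) \<le> dist x y"
          using infdist_diff[of y x] x y by (simp add: dist_commute)
      qed
    qed auto
    also have "ring (2 * n + s) \<union> (\<Union>j<n. ring (2 * j + s)) = (\<Union>j<Suc n. ring (2 * j + s))"
      by (auto simp: less_Suc_eq)
    finally show ?case .
  qed auto
  have partial: "(\<Sum>j<n. ?H (ring j)) \<le> 2 * ?H A" for n
  proof -
    have "(\<Sum>j<n. ?H (ring j)) \<le> (\<Sum>j<2*n. ?H (ring j))"
      by (intro sum_mono2) auto
    also have "\<dots> = (\<Sum>j<n. ?H (ring (2 * j + 0))) + (\<Sum>j<n. ?H (ring (2 * j + 1)))"
      by (induction n) (auto simp: algebra_simps)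
    also have "\<dots> \<le> ?H A + ?H A"
      by (intro add_mono order_trans[OF alternate] hausdorff_measure_mono) (auto simp: ring_def)
    finally show ?thesis
      by (simp add: mult_2)
  qed
  define s where "s = (\<Sum>j. ?H (ring j))"
  have s: "s = (SUP n. \<Sum>j<n. ?H (ring j))"
    unfolding s_def by (rule suminf_eq_SUP)
  have "s \<le> 2 * ?H A"
    unfolding s by (intro SUP_least partial)
  then have "s \<noteq> top"
    using finA by (auto simp: top_unique ennreal_mult_eq_top_iff)
  \<comment> \<open>Instead of sending the tail to 0, the first \<open>n\<close> ring measures are
    added on both sides. They complete the tail to the full sum \<open>s\<close>, which is finite
    and is cancelled at the end.\<close>
  have step: "(?H (A \<inter> C) + ?H (A - C)) + (\<Sum>j<n. ?H (ring j)) \<le> ?H A + s" for n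
  proof -
    have "?H (A - C) \<le> ?H (far n) + ?H (\<Union>j. ring (j + n))"
      using hausdorff_measure_mono[OF cover] hausdorff_measure_Un_le order_trans by blast
    also have "\<dots> \<le> ?H (far n) + (\<Sum>j. ?H (ring (j + n)))"
      by (intro add_mono hausdorff_measure_countable_subadditive) auto
    finally have "(?H (A \<inter> C) + ?H (A - C)) + (\<Sum>j<n. ?H (ring j)) \<le>
        (?H (A \<inter> C) + (?H (far n) + (\<Sum>j. ?H (ring (j + n))))) + (\<Sum>j<n. ?H (ring j))"
      by (intro add_mono) auto
    also have "\<dots> = (?H (A \<inter> C) + ?H (far n)) + ((\<Sum>j. ?H (ring (j + n))) + (\<Sum>j<n. ?H (ring j)))"
      by (simp add: ac_simps)
    also have "(\<Sum>j. ?H (ring (j + n))) + (\<Sum>j<n. ?H (ring j)) = s"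
      unfolding s_def by (rule suminf_offset[symmetric]) auto
    finally show ?thesis
      using far[of n] by (meson add_right_mono order_trans)
  qed
  have "(?H (A \<inter> C) + ?H (A - C)) + s = (SUP n. (?H (A \<inter> C) + ?H (A - C)) + (\<Sum>j<n. ?H (ring j)))"
    unfolding s by (rule ennreal_SUP_add_right) auto
  also have "\<dots> \<le> ?H A + s"
    by (intro SUP_least step)
  finally show ?thesis
    using \<open>s \<noteq> top\<close> by (simp add: add.commute[of _ s] ennreal_add_left_cancel_le)
qed auto

lemma measure_space_hausdorff_lambda:
  "measure_space UNIV (lambda_system UNIV UNIV (hausdorff_measure k)) (hausdorff_measure k :: 'a::metric_space set \<Rightarrow> _)"
proof -
  interpret sigma_algebra "UNIV :: 'a set" UNIV
    using sigma_algebra_Pow[of "UNIV :: 'a set"] by simp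
  show ?thesis
    by (rule caratheodory_lemma[OF outer_measure_space_hausdorff])
qed

lemma hausdorff_measure_borel_lambda:
  fixes A :: "'a::metric_space set"
  assumes "A \<in> sets borel"
  shows "A \<in> lambda_system UNIV UNIV (hausdorff_measure k)"
proof -
  interpret sigma_algebra "UNIV :: 'a set" UNIV
    using sigma_algebra_Pow[of "UNIV :: 'a set"] by simp
  have sa: "sigma_algebra (UNIV :: 'a set) (lambda_system UNIV UNIV (hausdorff_measure k))"
    using measure_space_hausdorff_lambda by (auto simp: measure_space_def)
  have "S \<in> lambda_system UNIV UNIV (hausdorff_measure k)" if "open S" for S :: "'a set"
  proof -
    have "hausdorff_measure k (B \<inter> S) + hausdorff_measure k (B - S) = hausdorff_measure k B" for B
    proof (rule antisym)
      have "B \<inter> - S = B - S" "B - (- S) = B \<inter> S"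
        by auto
      then show "hausdorff_measure k (B \<inter> S) + hausdorff_measure k (B - S) \<le> hausdorff_measure k B"
        using hausdorff_measure_split_closed[of "- S" k B] that by (simp add: closed_Compl add.commute)
      have "(B \<inter> S) \<union> (B - S) = B"
        by auto
      then show "hausdorff_measure k B \<le> hausdorff_measure k (B \<inter> S) + hausdorff_measure k (B - S)"
        by (metis hausdorff_measure_Un_le)
    qed
    then show ?thesis
      by (simp add: lambda_system_eq)
  qed
  then have "sigma_sets UNIV {S :: 'a set. open S} \<subseteq> lambda_system UNIV UNIV (hausdorff_measure k)"
    by (intro sigma_algebra.sigma_sets_subset[OF sa]) auto
  then show ?thesis
    using assms by (auto simp: borel_def)
qed

text \<open>On Borel sets the outer measure is a measure, so that densities, image measures and
  Fubini's theorem apply to it.\<close>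

definition hmeasure :: "nat \<Rightarrow> 'a::metric_space measure" where
  "hmeasure k = measure_of UNIV (sets borel) (hausdorff_measure k)"

lemma sets_hmeasure [simp, measurable_cong]: "sets (hmeasure k) = sets borel"
  and space_hmeasure [simp]: "space (hmeasure k) = UNIV"
  using sets.space_closed[of borel] sets.sigma_sets_eq[of borel]
  by (auto simp: hmeasure_def)

lemma emeasure_hmeasure:
  assumes "A \<in> sets borel"
  shows "emeasure (hmeasure k) A = hausdorff_measure k A"
proof (rule emeasure_measure_of[OF hmeasure_def])
  have "countably_additive (lambda_system UNIV UNIV (hausdorff_measure k)) (hausdorff_measure k :: 'a set \<Rightarrow> _)"
    using measure_space_hausdorff_lambda by (auto simp: measure_space_def)
  then show "countably_additive (sets (hmeasure k)) (hausdorff_measure k :: 'a set \<Rightarrow> _)"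
    using hausdorff_measure_borel_lambda unfolding countably_additive_def
    by (metis (no_types, lifting) image_subset_iff sets_hmeasure)
qed (use assms in \<open>auto simp: positive_def\<close>)

text \<open>Taking closures does not change diameters, so covers may be taken closed. Almost optimal
  closed covers with mesh tending to 0 are intersected over all \<open>m\<close>; each of them still
  covers the resulting Borel set.\<close>

lemma hausdorff_measure_borel_hull:
  fixes B :: "'a::metric_space set"
  obtains B' where "B' \<in> sets borel" "B \<subseteq> B'" "hausdorff_measure k B' = hausdorff_measure k B"
proof (cases "hausdorff_measure k B = top")
  case True
  show thesis
    using True hausdorff_measure_mono[of B UNIV k] by (intro that[of UNIV]) (auto simp: top_unique)
next
  case False
  let ?H = "hausdorff_measure k :: 'a set \<Rightarrow> ennreal"
  have "\<exists>E. B \<subseteq> (\<Union>i. E i) \<and> (\<forall>i. bounded (E i) \<and> diameter (E i) \<le> inverse (real (Suc m))) \<and>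
      (\<Sum>i. ennreal (hausdorff_weight k (E i))) < ?H B + ennreal (inverse (real (Suc m)))" for m
  proof -
    have "hausdorff_premeasure k (inverse (real (Suc m))) B < ?H B + ennreal (inverse (real (Suc m)))"
      using False hausdorff_premeasure_le_measure[of "inverse (real (Suc m))" k B]
      by (intro order.strict_trans1[OF hausdorff_premeasure_le_measure]) (auto simp: ennreal_add_less_top less_top)
    then show ?thesis
      unfolding hausdorff_premeasure_def INF_less_iff by auto
  qed
  then obtain E where E: "\<And>m. B \<subseteq> (\<Union>i. E m i)" "\<And>m i. bounded (E m i)"
      "\<And>m i. diameter (E m i) \<le> inverse (real (Suc m))"
      "\<And>m. (\<Sum>i. ennreal (hausdorff_weight k (E m i))) < ?H B + ennreal (inverse (real (Suc m)))"
    by metis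
  define B' where "B' = (\<Inter>m. \<Union>i. closure (E m i))"
  have "B \<subseteq> B'"
    using E(1) closure_subset unfolding B'_def by blast
  have "?H B' \<le> ?H B"
  proof (rule hausdorff_measure_le, rule ennreal_le_epsilon)
    fix \<delta> e :: real assume "0 < \<delta>" "0 < e"
    then obtain m where m: "inverse (real (Suc m)) < min \<delta> e"
      using reals_Archimedean[of "min \<delta> e"] by auto
    have "hausdorff_premeasure k \<delta> B' \<le> (\<Sum>i. ennreal (hausdorff_weight k (closure (E m i))))"
    proof (rule hausdorff_premeasure_le)
      show "diameter (closure (E m i)) \<le> \<delta>" for i
        using E(2,3)[of m i] m by (simp add: diameter_closure)
    qed (use E in \<open>auto simp: B'_def\<close>)
    also have "\<dots> = (\<Sum>i. ennreal (hausdorff_weight k (E m i)))"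
      using diameter_closure[OF E(2)] by (simp add: hausdorff_weight_def cong: if_cong)
    also have "\<dots> \<le> ?H B + ennreal (inverse (real (Suc m)))"
      using E(4) less_imp_le by blast
    also have "\<dots> \<le> ?H B + ennreal e"
      using m by (intro add_mono ennreal_leI) auto
    finally show "hausdorff_premeasure k \<delta> B' \<le> ?H B + ennreal e" .
  qed
  then show thesis
    using \<open>B \<subseteq> B'\<close> hausdorff_measure_mono[OF \<open>B \<subseteq> B'\<close>, of k]
    by (intro that[of B']) (auto simp: B'_def)
qed

subsection \<open>Hausdorff measure on hyperplanes\<close>

lemma hausdorff_premeasure_finite_cover:
  assumes "finite I" "A \<subseteq> (\<Union>i\<in>I. E i)" "\<delta> \<ge> 0"
    and E: "\<And>i. i \<in> I \<Longrightarrow> bounded (E i)" "\<And>i. i \<in> I \<Longrightarrow> diameter (E i) \<le> \<delta>"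
  shows "hausdorff_premeasure k \<delta> A \<le> (\<Sum>i\<in>I. ennreal (hausdorff_weight k (E i)))"
proof -
  obtain g where g: "bij_betw g {..<card I} I"
    using ex_bij_betw_nat_finite[OF \<open>finite I\<close>] by (auto simp: atLeast0LessThan)
  define F where "F i = (if i < card I then E (g i) else {})" for i
  have gI: "g i \<in> I" if "i < card I" for i
    using g that by (auto simp: bij_betw_def)
  have "hausdorff_premeasure k \<delta> A \<le> (\<Sum>i. ennreal (hausdorff_weight k (F i)))"
  proof (rule hausdorff_premeasure_le)
    show "A \<subseteq> (\<Union>i. F i)"
    proof
      fix x assume "x \<in> A"
      then obtain j where "j \<in> I" "x \<in> E j"
        using assms(2) by auto
      then have "j \<in> g ` {..<card I}"
        using g by (simp add: bij_betw_def)
      then obtain i where "i < card I" "g i = j"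
        by auto
      then show "x \<in> (\<Union>i. F i)"
        using \<open>x \<in> E j\<close> by (auto simp: F_def intro!: exI[of _ i])
    qed
  qed (use gI E \<open>\<delta> \<ge> 0\<close> in \<open>auto simp: F_def\<close>)
  also have "\<dots> = (\<Sum>i<card I. ennreal (hausdorff_weight k (F i)))"
    by (rule suminf_finite) (auto simp: F_def)
  also have "\<dots> = (\<Sum>i<card I. ennreal (hausdorff_weight k (E (g i))))"
    by (rule sum.cong) (auto simp: F_def)
  also have "\<dots> = (\<Sum>i\<in>I. ennreal (hausdorff_weight k (E i)))"
    by (rule sum.reindex_bij_betw[OF g])
  finally show ?thesis .
qed

text \<open>With \<open>d = CARD('n) - 1\<close>, the face is cut into \<open>N ^ d\<close> cells of
  side \<open>1 / N\<close>. The l1 norm bounds their diameter by \<open>CARD('n) / N\<close>, so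
  each has weight at most \<open>c / N ^ d\<close>, and the total is at most \<open>c\<close> for
  every mesh.\<close>

lemma hausdorff_measure_unit_face_finite:
  fixes k :: "'n::finite"
  shows "hausdorff_measure (CARD('n) - 1) {x::real^'n. x $ k = 0 \<and> (\<forall>i. 0 \<le> x $ i \<and> x $ i < 1)} < top"
    (is "hausdorff_measure ?d ?Q < top")
proof -
  define c where "c = unit_ball_vol (real ?d) * (real CARD('n) / 2) ^ ?d"
  have "hausdorff_measure ?d ?Q \<le> ennreal c"
  proof (rule hausdorff_measure_le)
    fix \<delta> :: real assume "0 < \<delta>"
    define N where "N = Suc (nat \<lceil>real CARD('n) / \<delta>\<rceil>)"
    have "N > 0" and "real CARD('n) / \<delta> \<le> real N"
      unfolding N_def by linarith+
    then have N: "real CARD('n) / real N \<le> \<delta>"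
      using \<open>0 < \<delta>\<close> by (simp add: field_simps)
    define I where "I = (\<Pi>\<^sub>E i\<in>UNIV - {k}. {..<N})"
    define cell where "cell f = {x::real^'n. x $ k = 0 \<and>
        (\<forall>i\<in>UNIV - {k}. real (f i) / real N \<le> x $ i \<and> x $ i \<le> real (f i + 1) / real N)}" for f
    have "finite I" "card I = N ^ ?d"
      unfolding I_def by (auto intro: finite_PiE simp: card_PiE card_Diff_singleton)
    have dist: "norm (x - y) \<le> real CARD('n) / real N" if "x \<in> cell f" "y \<in> cell f" for x y f
    proof -
      have "\<bar>(x - y) $ i\<bar> \<le> 1 / real N" for i
      proof (cases "i = k")
        case False
        have "\<bar>x $ i - y $ i\<bar> \<le> real (f i + 1) / real N - real (f i) / real N"
        proof -
          have "real (f i) / real N \<le> x $ i" "x $ i \<le> real (f i + 1) / real N"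
            "real (f i) / real N \<le> y $ i" "y $ i \<le> real (f i + 1) / real N"
            using that False by (auto simp: cell_def)
          then show ?thesis
            by linarith
        qed
        also have "\<dots> = 1 / real N"
          by (simp add: diff_divide_distrib[symmetric])
        finally show ?thesis
          by simp
      qed (use that in \<open>auto simp: cell_def\<close>)
      then have "(\<Sum>i\<in>UNIV. \<bar>(x - y) $ i\<bar>) \<le> (\<Sum>i\<in>(UNIV::'n set). 1 / real N)"
        by (intro sum_mono)
      then show ?thesis
        using norm_le_l1_cart[of "x - y"] by simp
    qed
    have diam: "diameter (cell f) \<le> real CARD('n) / real N" for f
      by (intro diameter_le dist) auto
    have bdd: "bounded (cell f)" for f
      unfolding bounded_two_points using dist[of _ f] by (auto simp: dist_norm)
    have "?Q \<subseteq> (\<Union>f\<in>I. cell f)"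
    proof
      fix x assume x: "x \<in> ?Q"
      \<comment> \<open>Coordinates are below 1, so each floor is below \<open>N\<close>;
        \<open>restrict\<close> makes the function extensional, as membership in \<open>I\<close>
        demands.\<close>
      define f where "f = restrict (\<lambda>i. nat \<lfloor>real N * x $ i\<rfloor>) (UNIV - {k})"
      have nonneg: "0 \<le> real N * x $ i" and "real N * x $ i < real N" for i
        using x \<open>N > 0\<close> by auto
      then have "nat \<lfloor>real N * x $ i\<rfloor> < N" for i
        by (simp add: nat_less_iff floor_less_iff)
      then have "f \<in> I"
        unfolding I_def f_def by auto
      moreover have "x \<in> cell f"
      proof -
        have "real (nat \<lfloor>real N * x $ i\<rfloor>) / real N \<le> x $ i \<and> x $ i \<le> real (nat \<lfloor>real N * x $ i\<rfloor> + 1) / real N" for i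
        proof -
          define t where "t = real N * x $ i"
          have t: "0 \<le> t" "x $ i = t / real N"
            using nonneg \<open>N > 0\<close> by (auto simp: t_def)
          have "real (nat \<lfloor>t\<rfloor>) = of_int \<lfloor>t\<rfloor>"
            using t(1) by simp
          then have "real (nat \<lfloor>t\<rfloor>) \<le> t" "t \<le> real (nat \<lfloor>t\<rfloor> + 1)"
            using of_int_floor_le[of t] real_of_int_floor_add_one_ge[of t]
            by (simp_all only: of_nat_add of_nat_1)
          then show ?thesis
            unfolding t_def[symmetric] by (simp only: t(2) divide_right_mono of_nat_0_le_iff simp_thms)
        qed
        then show ?thesis
          using x by (auto simp: cell_def f_def)
      qed
      ultimately show "x \<in> (\<Union>f\<in>I. cell f)"
        by blast
    qed
    then have "hausdorff_premeasure ?d \<delta> ?Q \<le> (\<Sum>f\<in>I. ennreal (hausdorff_weight ?d (cell f)))"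
      using \<open>0 < \<delta>\<close> diam N bdd by (intro hausdorff_premeasure_finite_cover \<open>finite I\<close>) (auto intro: order_trans)
    also have "\<dots> \<le> (\<Sum>f\<in>I. ennreal (c / real N ^ ?d))"
    proof (intro sum_mono ennreal_leI)
      fix f
      have "(diameter (cell f) / 2) ^ ?d \<le> (real CARD('n) / real N / 2) ^ ?d"
        using diam[of f] bdd[of f] by (intro power_mono) (auto simp: diameter_ge_0)
      also have "\<dots> = (real CARD('n) / 2) ^ ?d / real N ^ ?d"
        by (simp add: power_divide field_simps)
      finally have "unit_ball_vol (real ?d) * (diameter (cell f) / 2) ^ ?d \<le> c / real N ^ ?d"
        unfolding c_def times_divide_eq_right[symmetric] by (intro mult_left_mono) auto
      moreover have "0 \<le> c / real N ^ ?d"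
        by (simp add: c_def)
      ultimately show "hausdorff_weight ?d (cell f) \<le> c / real N ^ ?d"
        by (simp add: hausdorff_weight_def)
    qed
    also have "\<dots> = ennreal (real (card I) * (c / real N ^ ?d))"
      by (simp only: sum_constant ennreal_of_nat_eq_real_of_nat ennreal_mult'[OF of_nat_0_le_iff])
    also have "real (card I) * (c / real N ^ ?d) = c"
      using \<open>N > 0\<close> by (simp add: \<open>card I = N ^ ?d\<close>)
    finally show "hausdorff_premeasure ?d \<delta> ?Q \<le> ennreal c" .
  qed
  then show ?thesis
    by (rule le_less_trans[OF _ ennreal_less_top])
qed

text \<open>This supplies the sigma-finiteness on which Fubini depends. A rotation takes the
  hyperplane to a coordinate hyperplane, where a scaled copy of the unit face covers the bounded
  set.\<close>

lemma hausdorff_measure_hyperplane_finite: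
  fixes u :: "real^'n"
  assumes "norm u = 1" "bounded B" "\<And>x. x \<in> B \<Longrightarrow> x \<bullet> u = 0"
  shows "hausdorff_measure (CARD('n) - 1) B < top"
proof -
  let ?d = "CARD('n) - 1"
  obtain k :: 'n where True by simp
  obtain R :: "real^'n \<Rightarrow> real^'n" where R: "orthogonal_transformation R" "R u = axis k 1"
    using orthogonal_transformation_exists_1[OF assms(1) norm_axis_1] by blast
  obtain r where "r > 0" and r: "\<And>x. x \<in> B \<Longrightarrow> norm x \<le> r"
    using \<open>bounded B\<close> bounded_pos by blast
  let ?Q = "{x::real^'n. x $ k = 0 \<and> (\<forall>i. 0 \<le> x $ i \<and> x $ i < 1)}"
  \<comment> \<open>Points of norm at most \<open>r\<close> have coordinates in [-r, r]. Stretching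
    by \<open>4 * r\<close> about 1/2 places the preimages of the coordinates other than
    \<open>k\<close> in [1/4, 3/4], safely inside the half-open face.\<close>
  define f where "f x = (\<chi> i. if i = k then 0 else 4 * r * (x $ i - 1 / 2))" for x :: "real^'n"
  have "R ` B \<subseteq> f ` ?Q"
  proof
    fix y assume "y \<in> R ` B"
    then obtain x where x: "x \<in> B" "y = R x" by auto
    have "y \<bullet> axis k 1 = x \<bullet> u"
      using R x by (metis orthogonal_transformation_def)
    then have "y $ k = 0"
      using assms(3)[OF x(1)] by (simp add: inner_axis)
    have "norm y \<le> r"
      using x r R by (simp add: orthogonal_transformation_norm)
    then have y: "\<bar>y $ i\<bar> \<le> r" for i
      using component_le_norm_cart[of y i] by linarith
    define x' where "x' = (\<chi> i. if i = k then 0 else y $ i / (4 * r) + 1 / 2)"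
    have "\<bar>y $ i / (4 * r)\<bar> \<le> 1 / 4" for i
      using y[of i] \<open>r > 0\<close> by (simp add: abs_divide field_simps)
    then have "0 \<le> x' $ i \<and> x' $ i < 1" for i
      using abs_le_D1[of "y $ i / (4 * r)" "1 / 4"] abs_le_D2[of "y $ i / (4 * r)" "1 / 4"]
      by (cases "i = k") (simp_all add: x'_def)
    then have "x' \<in> ?Q"
      by (simp add: x'_def)
    moreover have "y = f x'"
      using \<open>y $ k = 0\<close> \<open>r > 0\<close> by (simp add: f_def x'_def vec_eq_iff)
    ultimately show "y \<in> f ` ?Q"
      by blast
  qed
  have "hausdorff_measure ?d (f ` ?Q) \<le> ennreal ((4 * r) ^ ?d) * hausdorff_measure ?d ((\<lambda>x. x) ` ?Q)"
  proof (rule hausdorff_measure_image_le)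
    fix x y :: "real^'n"
    have "norm (f x - f y) \<le> norm ((4 * r) *\<^sub>R (x - y))"
      using \<open>r > 0\<close> by (intro norm_le_componentwise_cart) (auto simp: f_def abs_mult simp flip: right_diff_distrib)
    then show "dist (f x) (f y) \<le> 4 * r * dist x y"
      using \<open>r > 0\<close> by (simp add: dist_norm)
  qed (use \<open>r > 0\<close> in auto)
  also have "\<dots> < top"
    using hausdorff_measure_unit_face_finite[of k] by (simp add: ennreal_mult_less_top)
  finally have "hausdorff_measure ?d (f ` ?Q) < top" .
  moreover have "hausdorff_measure ?d (R ` B) = hausdorff_measure ?d B"
    using R by (intro hausdorff_measure_isometry) (simp add: orthogonal_transformation_isometry)
  ultimately show ?thesis
    using hausdorff_measure_mono[OF \<open>R ` B \<subseteq> f ` ?Q\<close>, of ?d] by simp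
qed

text \<open>Carried by the hyperplane but defined on all Borel sets of the whole space, so that
  translations and the product with \<open>lborel\<close> involve no subspace type. Lying in the
  hyperplane becomes an almost everywhere property.\<close>

definition hyperplane_measure :: "real^'n \<Rightarrow> (real^'n) measure" where
  "hyperplane_measure u = density (hmeasure (CARD('n) - 1)) (indicator {x. x \<bullet> u = 0})"

lemma sets_hyperplane_measure [simp, measurable_cong]: "sets (hyperplane_measure u) = sets borel"
  by (simp add: hyperplane_measure_def)

lemma space_hyperplane_measure [simp]: "space (hyperplane_measure u) = UNIV"
  by (simp add: hyperplane_measure_def)

lemma emeasure_hyperplane_measure:
  fixes u :: "real^'n"
  assumes "A \<in> sets borel"
  shows "emeasure (hyperplane_measure u) A = hausdorff_measure (CARD('n) - 1) (A \<inter> {x. x \<bullet> u = 0})"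
proof -
  have P: "{x. x \<bullet> u = 0} \<in> sets borel"
    by measurable
  have "emeasure (hyperplane_measure u) A = (\<integral>\<^sup>+ x. indicator {x. x \<bullet> u = 0} x * indicator A x \<partial>hmeasure (CARD('n) - 1))"
    unfolding hyperplane_measure_def using assms P by (subst emeasure_density) auto
  also have "\<dots> = (\<integral>\<^sup>+ x. indicator (A \<inter> {x. x \<bullet> u = 0}) x \<partial>hmeasure (CARD('n) - 1))"
    by (intro nn_integral_cong) (simp split: split_indicator)
  also have "\<dots> = hausdorff_measure (CARD('n) - 1) (A \<inter> {x. x \<bullet> u = 0})"
    using assms P by (simp add: emeasure_hmeasure)
  finally show ?thesis .
qed

lemma AE_hyperplane_measure: "AE x in hyperplane_measure u. x \<bullet> u = 0"
proof -
  have [measurable]: "{x. x \<bullet> u = 0} \<in> sets borel"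
    by measurable
  show ?thesis
    unfolding hyperplane_measure_def by (subst AE_density) (auto simp: indicator_def)
qed

lemma sigma_finite_hyperplane_measure:
  fixes u :: "real^'n"
  assumes "norm u = 1"
  shows "sigma_finite_measure (hyperplane_measure u)"
proof
  have "emeasure (hyperplane_measure u) (cball 0 (real i)) < top" for i
  proof -
    have "bounded (cball 0 (real i) \<inter> {x. x \<bullet> u = 0})"
      by (rule bounded_subset[OF bounded_cball]) auto
    then have "hausdorff_measure (CARD('n) - 1) (cball 0 (real i) \<inter> {x. x \<bullet> u = 0}) < top"
      by (rule hausdorff_measure_hyperplane_finite[OF assms]) auto
    then show ?thesis
      by (subst emeasure_hyperplane_measure) auto
  qed
  then show "\<exists>A. countable A \<and> A \<subseteq> sets (hyperplane_measure u) \<and> \<Union> A = space (hyperplane_measure u) \<and>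
      (\<forall>a\<in>A. emeasure (hyperplane_measure u) a \<noteq> \<infinity>)"
    by (intro exI[of _ "range (\<lambda>i. cball 0 (real i))"]) (auto simp: real_arch_simple less_top)
qed

lemma nn_integral_hyperplane_translate:
  assumes "p \<bullet> u = 0" and f [measurable]: "f \<in> borel_measurable borel"
  shows "(\<integral>\<^sup>+ x. f (x + p) \<partial>hyperplane_measure u) = (\<integral>\<^sup>+ x. f x \<partial>hyperplane_measure u)"
proof -
  have "distr (hyperplane_measure u) borel (\<lambda>x. x + p) = hyperplane_measure u"
  proof (rule measure_eqI)
    fix A assume "A \<in> sets (distr (hyperplane_measure u) borel (\<lambda>x. x + p))"
    then have A [measurable]: "A \<in> sets borel" by simp
    have pre: "(\<lambda>x. x + p) -` A \<in> sets borel"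
      using measurable_sets_borel[of "\<lambda>x. x + p" borel A] by simp
    have "A \<inter> {x. x \<bullet> u = 0} = (\<lambda>x. x + p) ` ((\<lambda>x. x + p) -` A \<inter> {x. x \<bullet> u = 0})"
    proof (intro set_eqI iffI)
      fix x assume "x \<in> A \<inter> {x. x \<bullet> u = 0}"
      then show "x \<in> (\<lambda>x. x + p) ` ((\<lambda>x. x + p) -` A \<inter> {x. x \<bullet> u = 0})"
        using assms(1) by (intro image_eqI[of _ _ "x - p"]) (auto simp: inner_diff_left)
    qed (use assms(1) in \<open>auto simp: inner_add_left\<close>)
    then show "emeasure (distr (hyperplane_measure u) borel (\<lambda>x. x + p)) A = emeasure (hyperplane_measure u) A"
      using pre by (simp add: emeasure_distr emeasure_hyperplane_measure hausdorff_measure_isometry)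
  qed simp
  then show ?thesis
    using nn_integral_distr[of "\<lambda>x. x + p" "hyperplane_measure u" borel f] by simp
qed

lemma nn_integral_lborel_plus:
  fixes c :: "'a::euclidean_space"
  assumes [measurable]: "f \<in> borel_measurable borel"
  shows "(\<integral>\<^sup>+ y. f (c + y) \<partial>lborel) = (\<integral>\<^sup>+ y. f y \<partial>lborel)"
  using nn_integral_distr[of "(+) c" lborel borel f] by (simp add: lborel_distr_plus)

lemma nn_integral_lborel_minus:
  fixes c :: "'a::euclidean_space"
  assumes [measurable]: "f \<in> borel_measurable borel"
  shows "(\<integral>\<^sup>+ y. f (c - y) \<partial>lborel) = (\<integral>\<^sup>+ y. f y \<partial>lborel)"
proof -
  have "lborel = distr lborel borel (\<lambda>y. c - y)"
    using lborel_affine[of "-1" c] by (simp add: density_1)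
  then show ?thesis
    using nn_integral_distr[of "\<lambda>y. c - y" lborel borel f] by simp
qed

section \<open>Area in a hyperplane and the volume of prisms\<close>

definition prism :: "real^'n \<Rightarrow> (real^'n) set \<Rightarrow> (real^'n) set" where
  "prism u X = {y. y - (y \<bullet> u) *\<^sub>R u \<in> X \<and> 0 \<le> y \<bullet> u \<and> y \<bullet> u \<le> 1}"

lemma prism_borel [measurable]:
  fixes X :: "(real^'n) set"
  assumes "X \<in> sets borel"
  shows "prism u X \<in> sets borel"
proof -
  let ?p = "\<lambda>y::real^'n. y - (y \<bullet> u) *\<^sub>R u"
  have "?p \<in> borel_measurable borel"
    by (intro borel_measurable_continuous_onI continuous_intros)
  then have 1: "?p -` X \<in> sets borel"
    using measurable_sets_borel assms by blast
  have 2: "closed ((\<lambda>y. y \<bullet> u) -` {0..1})"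
    by (intro continuous_closed_vimage continuous_intros)
  have "prism u X = ?p -` X \<inter> (\<lambda>y. y \<bullet> u) -` {0..1}"
    unfolding prism_def by auto
  then show ?thesis
    using 1 borel_closed[OF 2] by (simp only: sets.Int)
qed

text \<open>Both \<open>hyperplane_measure u\<close> and Lebesgue measure are translation invariant, so evaluating
  \<open>\<integral>\<integral> 1\<^sub>B(x) 1(x + y \<in> prism u Q)\<close> in two ways shows that the ratio of the two measures is the same
  for all bases.\<close>

lemma hausdorff_measure_prism_ratio:
  fixes u :: "real^'n"
  assumes "norm u = 1"
    and [measurable]: "B \<in> sets borel" "Q \<in> sets borel"
    and B: "\<And>x. x \<in> B \<Longrightarrow> x \<bullet> u = 0" and Q: "\<And>x. x \<in> Q \<Longrightarrow> x \<bullet> u = 0"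
  shows "hausdorff_measure (CARD('n) - 1) B * emeasure lborel (prism u Q) =
         hausdorff_measure (CARD('n) - 1) Q * emeasure lborel (prism u B)"
proof -
  let ?\<nu> = "hyperplane_measure u"
  interpret \<nu>: sigma_finite_measure ?\<nu>
    by (rule sigma_finite_hyperplane_measure) fact
  interpret P: pair_sigma_finite ?\<nu> "lborel :: (real^'n) measure" ..
  have uu: "u \<bullet> u = 1"
    using \<open>norm u = 1\<close> by (simp add: dot_square_norm)
  define \<pi> where "\<pi> y = y - (y \<bullet> u) *\<^sub>R u" for y
  have [measurable]: "\<pi> \<in> borel_measurable borel"
    unfolding \<pi>_def by measurable
  have \<pi>u: "\<pi> y \<bullet> u = 0" for y
    by (simp add: \<pi>_def inner_diff_left uu)
  have B': "hausdorff_measure (CARD('n) - 1) B = emeasure ?\<nu> B"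
    and Q': "hausdorff_measure (CARD('n) - 1) Q = emeasure ?\<nu> Q"
    using B Q by (auto simp: emeasure_hyperplane_measure intro!: arg_cong[of _ _ "hausdorff_measure _"])
  have "emeasure ?\<nu> B * emeasure lborel (prism u Q) =
      (\<integral>\<^sup>+ x. indicator B x * (\<integral>\<^sup>+ y. indicator (prism u Q) y \<partial>lborel) \<partial>?\<nu>)"
    by (simp add: nn_integral_multc)
  also have "\<dots> = (\<integral>\<^sup>+ x. indicator B x * (\<integral>\<^sup>+ y. indicator (prism u Q) (x + y) \<partial>lborel) \<partial>?\<nu>)"
    by (subst nn_integral_lborel_plus) auto
  also have "\<dots> = (\<integral>\<^sup>+ x. \<integral>\<^sup>+ y. indicator B x * indicator (prism u Q) (x + y) \<partial>lborel \<partial>?\<nu>)"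
    by (subst nn_integral_cmult) auto
  also have "\<dots> = (\<integral>\<^sup>+ y. \<integral>\<^sup>+ x. indicator B x * indicator (prism u Q) (x + y) \<partial>?\<nu> \<partial>lborel)"
    by (rule P.Fubini'[symmetric]) measurable
  \<comment> \<open>For fixed \<open>y\<close> the inner integral is shifted by the projection
    \<open>\<pi> y\<close>, a vector of the hyperplane. Afterwards the prism condition depends on
    \<open>y\<close> only through the height \<open>y \<bullet> u\<close>, and on \<open>x\<close>
    only through membership in \<open>Q\<close>.\<close>
  also have "\<dots> = (\<integral>\<^sup>+ y. \<integral>\<^sup>+ x. indicator B (x + (- \<pi> y)) * indicator (prism u Q) ((x + (- \<pi> y)) + y) \<partial>?\<nu> \<partial>lborel)"
    by (intro nn_integral_cong nn_integral_hyperplane_translate[symmetric]) (auto simp: \<pi>u)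
  also have "\<dots> = (\<integral>\<^sup>+ y. \<integral>\<^sup>+ x. indicator Q x * (indicator B (x - \<pi> y) * indicator {0..1} (y \<bullet> u)) \<partial>?\<nu> \<partial>lborel)"
  proof (rule nn_integral_cong, rule nn_integral_cong_AE)
    fix y
    show "AE x in ?\<nu>. indicator B (x + (- \<pi> y)) * indicator (prism u Q) ((x + (- \<pi> y)) + y) =
      (indicator Q x * (indicator B (x - \<pi> y) * indicator {0..1} (y \<bullet> u)) :: ennreal)"
      using AE_hyperplane_measure[of u]
    proof eventually_elim
      fix x assume "x \<bullet> u = 0"
      then have "x + (y \<bullet> u) *\<^sub>R u \<in> prism u Q \<longleftrightarrow> x \<in> Q \<and> y \<bullet> u \<in> {0..1}"
        by (auto simp: prism_def inner_add_left uu)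
      moreover have "(x + (- \<pi> y)) + y = x + (y \<bullet> u) *\<^sub>R u"
        by (simp add: \<pi>_def)
      ultimately show "indicator B (x + (- \<pi> y)) * indicator (prism u Q) ((x + (- \<pi> y)) + y) =
          (indicator Q x * (indicator B (x - \<pi> y) * indicator {0..1} (y \<bullet> u)) :: ennreal)"
        by (simp only: diff_conv_add_uminus indicator_def) auto
    qed
  qed
  also have "\<dots> = (\<integral>\<^sup>+ x. \<integral>\<^sup>+ y. indicator Q x * (indicator B (x - \<pi> y) * indicator {0..1} (y \<bullet> u)) \<partial>lborel \<partial>?\<nu>)"
    by (rule P.Fubini') measurable
  also have "\<dots> = (\<integral>\<^sup>+ x. indicator Q x * (\<integral>\<^sup>+ y. indicator B (x - \<pi> y) * indicator {0..1} (y \<bullet> u) \<partial>lborel) \<partial>?\<nu>)"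
    by (subst nn_integral_cmult) auto
  also have "\<dots> = (\<integral>\<^sup>+ x. indicator Q x * (\<integral>\<^sup>+ y. indicator (prism u B) y \<partial>lborel) \<partial>?\<nu>)"
  proof (rule nn_integral_cong_AE)
    show "AE x in ?\<nu>. indicator Q x * (\<integral>\<^sup>+ y. indicator B (x - \<pi> y) * indicator {0..1} (y \<bullet> u) \<partial>lborel) =
        indicator Q x * (\<integral>\<^sup>+ y. indicator (prism u B) y \<partial>lborel)"
      using AE_hyperplane_measure[of u]
    proof eventually_elim
      fix x assume x: "x \<bullet> u = 0"
      \<comment> \<open>Substituting \<open>x + u - y\<close> for \<open>y\<close> turns
        \<open>x - \<pi> y\<close> into \<open>\<pi> y\<close> and the height t into 1 - t, which
        maps [0, 1] to itself. The result no longer depends on \<open>x\<close>.\<close>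
      have "(\<integral>\<^sup>+ y. indicator B (x - \<pi> y) * indicator {0..1} (y \<bullet> u) \<partial>lborel) =
          (\<integral>\<^sup>+ y. indicator B (x - \<pi> ((x + u) - y)) * indicator {0..1} (((x + u) - y) \<bullet> u) \<partial>lborel)"
        by (rule nn_integral_lborel_minus[symmetric]) measurable
      also have "\<dots> = (\<integral>\<^sup>+ y. indicator (prism u B) y \<partial>lborel)"
      proof (intro nn_integral_cong)
        fix y
        have inner: "((x + u) - y) \<bullet> u = 1 - y \<bullet> u"
          by (simp add: inner_diff_left inner_add_left x uu)
        have pi: "x - \<pi> ((x + u) - y) = \<pi> y"
          unfolding \<pi>_def inner by (simp add: algebra_simps)
        show "indicator B (x - \<pi> ((x + u) - y)) * indicator {0..1} (((x + u) - y) \<bullet> u) =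
            (indicator (prism u B) y :: ennreal)"
          unfolding pi inner by (auto simp: indicator_def prism_def \<pi>_def)
      qed
      finally show "indicator Q x * (\<integral>\<^sup>+ y. indicator B (x - \<pi> y) * indicator {0..1} (y \<bullet> u) \<partial>lborel) =
        indicator Q x * (\<integral>\<^sup>+ y. indicator (prism u B) y \<partial>lborel)"
        by simp
    qed
  qed
  also have "\<dots> = emeasure ?\<nu> Q * emeasure lborel (prism u B)"
    by (simp add: nn_integral_multc)
  finally show ?thesis
    unfolding B' Q' .
qed

lemma norm_prism_le:
  fixes u :: "real^'n"
  assumes "norm u = 1" "y \<in> prism u X" "\<And>x. x \<in> X \<Longrightarrow> norm x \<le> r"
  shows "norm y \<le> r + 1"
proof -
  have "norm (y - (y \<bullet> u) *\<^sub>R u) \<le> r" "\<bar>y \<bullet> u\<bar> \<le> 1"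
    using assms by (auto simp: prism_def)
  then show ?thesis
    using norm_triangle_ineq[of "y - (y \<bullet> u) *\<^sub>R u" "(y \<bullet> u) *\<^sub>R u"] \<open>norm u = 1\<close> by simp
qed

lemma bounded_prism:
  fixes u :: "real^'n"
  assumes "norm u = 1" "bounded X"
  shows "bounded (prism u X)"
  using norm_prism_le[OF assms(1)] assms(2) unfolding bounded_iff by blast

text \<open>The base of comparison is the unit disc of the hyperplane: \<open>m\<close> is the
  volume of the prism over it and \<open>q\<close> its area. That prism is bounded and contains a
  ball of radius 1/2, which makes \<open>m\<close> cancellable.\<close>

lemma hausdorff_measure_eq_prism:
  fixes u :: "real^'n"
  assumes "norm u = 1"
  obtains m q where "m \<noteq> 0" "m \<noteq> top"
    "\<And>B. \<lbrakk>B \<in> sets borel; \<And>x. x \<in> B \<Longrightarrow> x \<bullet> u = 0\<rbrakk> \<Longrightarrow>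
      hausdorff_measure (CARD('n) - 1) B * m = q * emeasure lborel (prism u B)"
proof -
  define Q where "Q = {x. x \<bullet> u = 0} \<inter> cball 0 1"
  have Q [measurable]: "Q \<in> sets borel"
    unfolding Q_def by measurable
  have uu: "u \<bullet> u = 1"
    using assms by (simp add: dot_square_norm)
  show thesis
  proof
    \<comment> \<open>The ball is centred halfway up the axis, so heights stay strictly between 0
      and 1 and projections stay in the unit disc.\<close>
    have "ball ((1/2) *\<^sub>R u) (1/2) \<subseteq> prism u Q"
    proof
      fix y assume "y \<in> ball ((1/2) *\<^sub>R u) (1/2)"
      define d where "d = y - (1/2) *\<^sub>R u"
      have d: "norm d < 1/2" and y: "y = (1/2) *\<^sub>R u + d"
        using \<open>y \<in> _\<close> by (auto simp: d_def dist_norm norm_minus_commute)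
      have du: "\<bar>d \<bullet> u\<bar> < 1/2"
        using Cauchy_Schwarz_ineq2[of d u] d assms by simp
      have "y \<bullet> u = 1/2 + d \<bullet> u"
        by (simp add: y inner_add_left uu)
      moreover have "norm (d - (d \<bullet> u) *\<^sub>R u) \<le> 1"
        using norm_triangle_ineq4[of d "(d \<bullet> u) *\<^sub>R u"] d du assms by simp
      moreover have "y - (y \<bullet> u) *\<^sub>R u = d - (d \<bullet> u) *\<^sub>R u"
        unfolding \<open>y \<bullet> u = _\<close> by (simp add: y algebra_simps)
      ultimately show "y \<in> prism u Q"
        using du by (auto simp: prism_def Q_def inner_diff_left uu)
    qed
    then have "emeasure lborel (ball ((1/2) *\<^sub>R u) (1/2)) \<le> emeasure lborel (prism u Q)"
      by (intro emeasure_mono) auto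
    moreover have "emeasure lborel (ball ((1/2) *\<^sub>R u) (1/2)) > 0"
      by (simp add: emeasure_ball)
    ultimately show "emeasure lborel (prism u Q) \<noteq> 0"
      by auto
    have "bounded (prism u Q)"
      using assms by (intro bounded_prism) (auto simp: Q_def)
    then show "emeasure lborel (prism u Q) \<noteq> top"
      using emeasure_bounded_finite[of "prism u Q"] by (simp add: less_top)
    fix B assume "B \<in> sets borel" "\<And>x. x \<in> B \<Longrightarrow> x \<bullet> u = 0"
    then show "hausdorff_measure (CARD('n) - 1) B * emeasure lborel (prism u Q) =
        hausdorff_measure (CARD('n) - 1) Q * emeasure lborel (prism u B)"
      by (intro hausdorff_measure_prism_ratio assms Q) (auto simp: Q_def)
  qed
qed

section \<open>Determinants and volumes of linear images\<close>

lemma det_rank_one_perturbation: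
  fixes u z :: "real^'n"
  assumes "norm u = 1"
  shows "det (matrix (\<lambda>y. y + (y \<bullet> u) *\<^sub>R (z - u))) = z \<bullet> u"
proof -
  obtain k :: 'n where True by simp
  obtain R :: "real^'n \<Rightarrow> real^'n" where R: "orthogonal_transformation R" "R u = axis k 1"
    using orthogonal_transformation_exists_1[OF assms norm_axis_1] by blast
  have "linear R" and Rin: "R x \<bullet> R y = x \<bullet> y" for x y
    using R(1) by (auto simp: orthogonal_transformation_def)
  define G where "G y = y + (y \<bullet> u) *\<^sub>R (z - u)" for y
  define G' where "G' y = y + (y $ k) *\<^sub>R (R z - axis k 1)" for y
  have "linear G" "linear G'"
    by (auto intro!: linearI simp: G_def G'_def algebra_simps inner_add_left)
  \<comment> \<open>After rotating \<open>u\<close> to a basis vector, the map merely replaces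
    column \<open>k\<close> of the identity by \<open>R z\<close>; Cramer's rule then reads off
    coordinate \<open>k\<close> of \<open>R z\<close> as the determinant.\<close>
  have "matrix G' = (\<chi> i j. if j = k then (mat 1 *v R z) $ i else mat 1 $ i $ j)"
    unfolding matrix_vector_mul_lid by (auto simp: matrix_def G'_def vec_eq_iff axis_def mat_def)
  then have "det (matrix G') = R z $ k"
    using cramer_lemma[of k "mat 1" "R z"] by simp
  also have "\<dots> = z \<bullet> u"
    using Rin[of z u] by (simp add: R(2) inner_axis)
  finally have detG': "det (matrix G') = z \<bullet> u" .
  have "y \<bullet> u = R y $ k" for y
    using Rin[of y u] by (simp add: R(2) inner_axis)
  then have "R \<circ> G = G' \<circ> R"
    by (auto simp: fun_eq_iff G_def G'_def linear_add[OF \<open>linear R\<close>] linear_scale[OF \<open>linear R\<close>]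
        linear_diff[OF \<open>linear R\<close>] R(2))
  then have "det (matrix R) * det (matrix G) = det (matrix G') * det (matrix R)"
    using \<open>linear R\<close> \<open>linear G\<close> \<open>linear G'\<close> by (metis det_mul matrix_compose)
  moreover have "det (matrix R) \<noteq> 0"
    using orthogonal_transformation_det[OF R(1)] by auto
  ultimately show ?thesis
    using detG' unfolding G_def by simp
qed

text \<open>The library proves this only for well-ordered index types, because it computes the determinant of
  a shear as that of a triangular matrix.\<close>

lemma lmeasure_linear_image:
  fixes f :: "real^'n \<Rightarrow> real^'n"
  assumes "linear f"
  shows "\<forall>S\<in>lmeasurable. f ` S \<in> lmeasurable \<and>
    measure lebesgue (f ` S) = \<bar>det (matrix f)\<bar> * measure lebesgue S"
    (is "?P f")
  using assms
proof (rule induct_linear_elementary)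
  fix f g :: "real^'n \<Rightarrow> real^'n"
  assume fg: "linear f" "linear g" "?P f" "?P g"
  have m: "matrix (f \<circ> g) = matrix f ** matrix g"
    using fg by (intro matrix_compose)
  show "?P (f \<circ> g)"
    unfolding m image_comp[symmetric] det_mul abs_mult using fg(3,4) by simp
next
  fix f :: "real^'n \<Rightarrow> real^'n" and i
  assume f: "linear f" "\<And>x. f x $ i = 0"
  have "\<not> surj f"
  proof
    assume "surj f"
    then obtain x where "f x = axis i 1"
      by (metis surjD)
    then show False
      using f(2)[of x] by simp
  qed
  then have ninj: "\<not> inj f"
    using linear_injective_imp_surjective[OF f(1)] by blast
  then have "negligible (f ` S)" for S
    by (rule negligible_linear_singular_image[OF f(1)])
  moreover have "det (matrix f) = 0"
    using det_nz_iff_inj[OF f(1)] ninj by blast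
  ultimately show "?P f"
    by (simp add: negligible_iff_measure)
next
  fix c :: "'n \<Rightarrow> real"
  have "det (matrix (\<lambda>x. \<chi> i. c i * x $ i)) = prod c UNIV"
    by (subst det_diagonal) (auto simp: matrix_def axis_def)
  then show "?P (\<lambda>x. \<chi> i. c i * x $ i)"
    by (simp add: measurable_stretch measure_stretch)
next
  fix m n :: 'n
  assume "m \<noteq> n"
  define h where "h = (\<lambda>x::real^'n. \<chi> i. x $ Transposition.transpose m n i)"
  have lin: "linear h"
    by (rule linearI) (simp_all add: h_def vec_eq_iff)
  have hh: "h (h x) = x" for x
    by (simp add: h_def vec_eq_iff)
  \<comment> \<open>A transposition of coordinates is an involution, so its determinant squares to
    1, and only the absolute value enters the claim.\<close>
  have "matrix h ** matrix h = mat 1"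
    using hh matrix_compose[OF lin lin] by (simp add: o_def matrix_id_mat_1[unfolded id_def])
  then have "det (matrix h) * det (matrix h) = 1"
    by (metis det_I det_mul)
  then have det: "\<bar>det (matrix h)\<bar> = 1"
    unfolding square_eq_1_iff by auto
  have box: "measure lebesgue (h ` cbox a b) = 1 * measure lebesgue (cbox a b)" for a b
  proof -
    have iff: "h x \<in> cbox (h a) (h b) \<longleftrightarrow> x \<in> cbox a b" for x
      unfolding mem_box_cart h_def vec_lambda_beta by (metis transpose_involutory)
    have eq: "h ` cbox a b = cbox (h a) (h b)"
    proof (intro set_eqI iffI)
      fix y assume "y \<in> cbox (h a) (h b)"
      then show "y \<in> h ` cbox a b"
        using iff[of "h y"] hh by (intro image_eqI[of _ _ "h y"]) simp_all
    qed (auto simp: iff)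
    then have "cbox (h a) (h b) = {} \<longleftrightarrow> cbox a b = {}"
      by (metis image_is_empty)
    moreover have "(\<Prod>i\<in>UNIV. h b $ i - h a $ i) = (\<Prod>i\<in>UNIV. b $ i - a $ i)"
      using prod.permute[OF permutes_swap_id[of m UNIV n], of "\<lambda>i. b $ i - a $ i"]
      by (simp add: h_def o_def)
    ultimately show ?thesis
      unfolding eq by (simp add: content_cbox_if_cart)
  qed
  show "?P (\<lambda>x. \<chi> i. x $ Transposition.transpose m n i)"
    unfolding h_def[symmetric] det
  proof
    fix S :: "(real^'n) set" assume "S \<in> lmeasurable"
    from measure_linear_sufficient[OF lin this box]
    show "h ` S \<in> lmeasurable \<and> measure lebesgue (h ` S) = 1 * measure lebesgue S"
      by (simp only:)
  qed
next
  fix m n :: 'n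
  assume "m \<noteq> n"
  define h where "h = (\<lambda>x::real^'n. \<chi> i. if i = m then x $ m + x $ n else x $ i)"
  have lin: "linear h"
    by (rule linearI) (simp_all add: h_def vec_eq_iff algebra_simps)
  \<comment> \<open>The shear replaces \<open>axis n 1\<close> by
    \<open>axis n 1 + axis m 1\<close>, and the inner product of these two vectors is 1 because
    \<open>m\<close> and \<open>n\<close> differ.\<close>
  have "h = (\<lambda>x. x + (x \<bullet> axis n 1) *\<^sub>R ((axis n 1 + axis m 1) - axis n 1))"
    unfolding inner_axis by (auto simp: h_def fun_eq_iff vec_eq_iff axis_def)
  then have "det (matrix h) = (axis n 1 + axis m 1) \<bullet> axis n (1::real)"
    by (simp only: det_rank_one_perturbation norm_axis_1)
  then have det: "\<bar>det (matrix h)\<bar> = 1"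
    using \<open>m \<noteq> n\<close> unfolding inner_axis by (simp add: axis_def)
  have box: "measure lebesgue (h ` cbox a b) = 1 * measure lebesgue (cbox a b)" for a b
  proof (cases "cbox a b = {}")
    case False
    \<comment> \<open>\<open>measure_shear_interval\<close> asks for a nonnegative lower corner in
      coordinate \<open>n\<close>; this translation moves that coordinate to 0.\<close>
    define v where "v = axis n (- a $ n)"
    have "h ` cbox (v + a) (v + b) = (+) (h v) ` h ` cbox a b"
      unfolding cbox_translation by (simp add: image_image linear_add[OF lin])
    then have "measure lebesgue (h ` cbox a b) = measure lebesgue (h ` cbox (v + a) (v + b))"
      by (simp only: measure_translation)
    also have "\<dots> = measure lebesgue (cbox (v + a) (v + b))"
      unfolding h_def using False \<open>m \<noteq> n\<close>
      by (intro measure_shear_interval) (auto simp: cbox_translation v_def)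
    also have "\<dots> = measure lebesgue (cbox a b)"
      by (simp only: cbox_translation measure_translation)
    finally show ?thesis
      by simp
  qed simp
  show "?P (\<lambda>x. \<chi> i. if i = m then x $ m + x $ n else x $ i)"
    unfolding h_def[symmetric] det
  proof
    fix S :: "(real^'n) set" assume "S \<in> lmeasurable"
    from measure_linear_sufficient[OF lin this box]
    show "h ` S \<in> lmeasurable \<and> measure lebesgue (h ` S) = 1 * measure lebesgue S"
      by (simp only:)
  qed
qed

lemma emeasure_lborel_linear_image:
  fixes f :: "real^'n \<Rightarrow> real^'n"
  assumes "linear f" "X \<in> sets borel" "f ` X \<in> sets borel" "bounded X"
  shows "emeasure lborel (f ` X) = ennreal \<bar>det (matrix f)\<bar> * emeasure lborel X"
proof -
  have lm: "Y \<in> lmeasurable" "emeasure lborel Y = ennreal (measure lebesgue Y)"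
    if "bounded Y" "Y \<in> sets borel" for Y :: "(real^'n) set"
  proof -
    show Y: "Y \<in> lmeasurable"
      using that by (intro bounded_set_imp_lmeasurable) auto
    show "emeasure lborel Y = ennreal (measure lebesgue Y)"
      using that emeasure_eq_measure2[OF Y] by simp
  qed
  have "bounded (f ` X)"
    using assms by (intro bounded_linear_image linear_conv_bounded_linear[THEN iffD1])
  then have "emeasure lborel (f ` X) = ennreal (measure lebesgue (f ` X))"
    using assms(3) by (rule lm(2))
  also have "measure lebesgue (f ` X) = \<bar>det (matrix f)\<bar> * measure lebesgue X"
    using lmeasure_linear_image[OF \<open>linear f\<close>] lm(1) assms by blast
  also have "ennreal \<dots> = ennreal \<bar>det (matrix f)\<bar> * ennreal (measure lebesgue X)"
    by (rule ennreal_mult') simp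
  also have "ennreal (measure lebesgue X) = emeasure lborel X"
    using assms by (intro lm(2)[symmetric])
  finally show ?thesis .
qed

section \<open>Linear images of subsets of a hyperplane\<close>

lemma bij_linear_image_borel:
  fixes f :: "'a::euclidean_space \<Rightarrow> 'a"
  assumes "linear f" "bij f" "X \<in> sets borel"
  shows "f ` X \<in> sets borel"
proof -
  have "linear (inv f)"
    using inj_linear_imp_inv_linear[OF assms(1)] bij_is_inj[OF assms(2)] by simp
  then have "inv f \<in> borel_measurable borel"
    by (intro borel_measurable_continuous_onI linear_continuous_on) (simp add: linear_conv_bounded_linear)
  then have "inv f -` X \<in> sets borel"
    using measurable_sets_borel assms(3) by blast
  then show ?thesis
    using assms(2) by (simp add: bij_vimage_eq_inv_image bij_imp_bij_inv inv_inv_eq)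
qed

text \<open>\<open>T\<close> takes the hyperplane orthogonal to \<open>u\<close> to the one
  orthogonal to \<open>S u\<close>. The isometry \<open>R\<close> turns the latter back, so both
  areas can be read off prisms in the same direction \<open>u\<close>, with the same constants
  \<open>m\<close> and \<open>q\<close>. What remains is to compare the two volumes.\<close>

lemma hausdorff_measure_linear_image_borel:
  fixes T S :: "real^'n \<Rightarrow> real^'n"
  assumes T: "linear T" "bij T" and dual: "\<And>x y. T x \<bullet> S y = x \<bullet> y"
    and u: "norm u = 1" and B: "B \<in> sets borel" "bounded B" "\<And>x. x \<in> B \<Longrightarrow> x \<bullet> u = 0"
  shows "hausdorff_measure (CARD('n) - 1) (T ` B) =
    ennreal (\<bar>det (matrix T)\<bar> * norm (S u)) * hausdorff_measure (CARD('n) - 1) B"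
proof -
  have uu: "u \<bullet> u = 1"
    using u by (simp add: dot_square_norm)
  define w where "w = S u"
  have "w \<noteq> 0"
    using dual[of u u] uu by (auto simp: w_def)
  then have nw: "norm (w /\<^sub>R norm w) = norm u"
    using u by simp
  obtain R :: "real^'n \<Rightarrow> real^'n" where R: "orthogonal_transformation R" "R (w /\<^sub>R norm w) = u"
    using orthogonal_transformation_exists[OF nw] by blast
  have linR: "linear R" and Rin: "R x \<bullet> R y = x \<bullet> y" for x y
    using R(1) by (auto simp: orthogonal_transformation_def)
  define f where "f = R \<circ> T"
  have f: "linear f" "bij f"
    using linear_compose[OF T(1) linR] T(2) orthogonal_transformation_bij[OF R(1)]
    by (auto simp: f_def intro: bij_comp)
  have fu: "f x \<bullet> u = (x \<bullet> u) / norm w" for x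
  proof -
    have "f x \<bullet> u = T x \<bullet> (w /\<^sub>R norm w)"
      unfolding f_def o_def by (metis R(2) Rin)
    then show ?thesis
      using dual[of x u] by (simp add: w_def divide_inverse_commute)
  qed
  obtain z where z: "f z = u"
    using f(2) by (metis bij_pointE)
  have zu: "z \<bullet> u = norm w"
    using fu[of z] z uu \<open>w \<noteq> 0\<close> by (simp add: field_simps)
  \<comment> \<open>\<open>f\<close> preserves the hyperplane but may tilt \<open>u\<close>.
    \<open>G\<close> fixes the hyperplane pointwise and sends \<open>u\<close> to \<open>z\<close>,
    the preimage of \<open>u\<close> under \<open>f\<close>; hence the composition of
    \<open>f\<close> after \<open>G\<close> keeps the prism direction. The determinant of
    \<open>G\<close> is where the factor \<open>norm (S u)\<close> arises.\<close>
  define G where "G y = y + (y \<bullet> u) *\<^sub>R (z - u)" for y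
  have "linear G"
    by (auto intro!: linearI simp: G_def algebra_simps inner_add_left)
  have detG: "det (matrix G) = norm w"
    using det_rank_one_perturbation[OF u, of z] zu unfolding G_def by simp
  have fG: "f (G y) = f (y - (y \<bullet> u) *\<^sub>R u) + (y \<bullet> u) *\<^sub>R u" for y
    using z by (simp add: G_def linear_add[OF f(1)] linear_diff[OF f(1)] linear_scale[OF f(1)] algebra_simps)
  have fG_u: "f (G y) \<bullet> u = y \<bullet> u" for y
    unfolding fG by (simp add: inner_add_left fu inner_diff_left uu)
  have linfG: "linear (f \<circ> G)"
    using linear_compose[OF \<open>linear G\<close> f(1)] .
  have inj: "inj (f \<circ> G)"
  proof (rule linear_injective_0[OF linfG, THEN iffD2], intro allI impI)
    fix y assume "(f \<circ> G) y = 0"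
    then have "y \<bullet> u = 0" and "f (y - (y \<bullet> u) *\<^sub>R u) = 0"
      using fG_u[of y] fG[of y] by auto
    then show "y = 0"
      using f by (simp add: bij_is_inj linear_injective_0[THEN iffD1, rule_format])
  qed
  have prism_image: "prism u (f ` B) = (f \<circ> G) ` prism u B"
  proof (intro set_eqI iffI)
    fix y assume "y \<in> prism u (f ` B)"
    then obtain b where b: "b \<in> B" "y - (y \<bullet> u) *\<^sub>R u = f b" "0 \<le> y \<bullet> u" "y \<bullet> u \<le> 1"
      by (auto simp: prism_def)
    let ?x = "b + (y \<bullet> u) *\<^sub>R u"
    have "?x \<bullet> u = y \<bullet> u"
      using B(3)[OF b(1)] uu by (simp add: inner_add_left)
    then have "?x \<in> prism u B" "(f \<circ> G) ?x = y"
      using b by (simp_all add: prism_def fG) (simp add: algebra_simps)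
    then show "y \<in> (f \<circ> G) ` prism u B"
      by (metis image_eqI)
  next
    fix y assume "y \<in> (f \<circ> G) ` prism u B"
    then obtain x where x: "x \<in> prism u B" "y = f (G x)"
      by auto
    then have "y \<bullet> u = x \<bullet> u" "y - (x \<bullet> u) *\<^sub>R u = f (x - (x \<bullet> u) *\<^sub>R u)"
      using fG_u fG by simp_all
    then show "y \<in> prism u (f ` B)"
      using x by (auto simp: prism_def)
  qed
  have fB: "f ` B \<in> sets borel"
    using bij_linear_image_borel[OF f B(1)] .
  have "det (matrix (f \<circ> G)) = det (matrix R) * det (matrix T) * det (matrix G)"
    unfolding f_def using T linR \<open>linear G\<close>
    by (simp add: matrix_compose linear_compose det_mul)
  then have det: "\<bar>det (matrix (f \<circ> G))\<bar> = \<bar>det (matrix T)\<bar> * norm w"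
    using orthogonal_transformation_det[OF R(1)] detG by (simp add: abs_mult)
  have vol: "emeasure lborel (prism u (f ` B)) = ennreal (\<bar>det (matrix T)\<bar> * norm w) * emeasure lborel (prism u B)"
    unfolding det[symmetric] prism_image
  proof (rule emeasure_lborel_linear_image[OF linfG])
    show "(f \<circ> G) ` prism u B \<in> sets borel"
      unfolding prism_image[symmetric] using fB by (rule prism_borel)
  qed (use B u in \<open>auto intro: prism_borel bounded_prism\<close>)
  obtain m q where m: "m \<noteq> 0" "m \<noteq> top" and prism: "\<And>B. \<lbrakk>B \<in> sets borel; \<And>x. x \<in> B \<Longrightarrow> x \<bullet> u = 0\<rbrakk> \<Longrightarrow>
      hausdorff_measure (CARD('n) - 1) B * m = q * emeasure lborel (prism u B)"
    using hausdorff_measure_eq_prism[OF u] by blast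
  have "hausdorff_measure (CARD('n) - 1) (T ` B) = hausdorff_measure (CARD('n) - 1) (f ` B)"
    unfolding f_def image_comp[symmetric]
    using R(1) by (intro hausdorff_measure_isometry[symmetric]) (simp add: orthogonal_transformation_isometry)
  moreover have "hausdorff_measure (CARD('n) - 1) (f ` B) * m = q * emeasure lborel (prism u (f ` B))"
    using fB B(3) by (intro prism) (auto simp: fu)
  moreover have "hausdorff_measure (CARD('n) - 1) B * m = q * emeasure lborel (prism u B)"
    using B by (intro prism) auto
  ultimately have "hausdorff_measure (CARD('n) - 1) (T ` B) * m =
      (ennreal (\<bar>det (matrix T)\<bar> * norm w) * hausdorff_measure (CARD('n) - 1) B) * m"
    unfolding vol by (metis mult.assoc mult.left_commute)
  then show ?thesis
    unfolding w_def using m by (metis mult_divide_eq_ennreal)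
qed

text \<open>Meant for projected boundary pieces, which are not shown to be Borel. A Borel hull is
  cut down to a ball and to the hyperplane, where the Borel case applies, and it has no more measure
  than \<open>B\<close> itself.\<close>

lemma hausdorff_measure_linear_image_le:
  fixes T S :: "real^'n \<Rightarrow> real^'n"
  assumes T: "linear T" "bij T" and dual: "\<And>x y. T x \<bullet> S y = x \<bullet> y"
    and u: "norm u = 1" and B: "bounded B" "\<And>x. x \<in> B \<Longrightarrow> x \<bullet> u = 0"
  shows "hausdorff_measure (CARD('n) - 1) (T ` B) \<le>
    ennreal (\<bar>det (matrix T)\<bar> * norm (S u)) * hausdorff_measure (CARD('n) - 1) B"
proof -
  obtain B' where B': "B' \<in> sets borel" "B \<subseteq> B'"
      "hausdorff_measure (CARD('n) - 1) B' = hausdorff_measure (CARD('n) - 1) B"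
    using hausdorff_measure_borel_hull .
  obtain r where "\<forall>x\<in>B. norm x \<le> r"
    using B(1) unfolding bounded_iff by blast
  then have r: "B \<subseteq> cball 0 r"
    by auto
  define C where "C = B' \<inter> (cball 0 r \<inter> {x. x \<bullet> u = 0})"
  have closed: "closed {x. x \<bullet> u = 0}"
    using closed_hyperplane[of u 0] by (simp add: inner_commute)
  have "C \<in> sets borel"
    unfolding C_def by (rule sets.Int[OF B'(1) borel_closed]) (intro closed_Int closed_cball closed)
  moreover have "bounded C"
    unfolding C_def by (rule bounded_subset[OF bounded_cball[of 0 r]]) auto
  ultimately have C: "hausdorff_measure (CARD('n) - 1) (T ` C) =
      ennreal (\<bar>det (matrix T)\<bar> * norm (S u)) * hausdorff_measure (CARD('n) - 1) C"
    by (intro hausdorff_measure_linear_image_borel[OF T dual u]) (auto simp: C_def)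
  have "B \<subseteq> C" "C \<subseteq> B'"
    using B' r B(2) by (auto simp: C_def)
  have "hausdorff_measure (CARD('n) - 1) (T ` B) \<le> hausdorff_measure (CARD('n) - 1) (T ` C)"
    by (intro hausdorff_measure_mono image_mono \<open>B \<subseteq> C\<close>)
  also have "\<dots> \<le> ennreal (\<bar>det (matrix T)\<bar> * norm (S u)) * hausdorff_measure (CARD('n) - 1) B'"
    unfolding C by (intro mult_left_mono hausdorff_measure_mono \<open>C \<subseteq> B'\<close>) simp
  finally show ?thesis
    unfolding B'(3) .
qed

text \<open>The prism over a subspace of codimension two stays in the hyperplane orthogonal to
  \<open>v\<close>, because projecting along \<open>u\<close> does not change inner products with
  \<open>v\<close>. Its volume is therefore 0.\<close>

lemma hausdorff_measure_codim2_null: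
  fixes u v :: "real^'n"
  assumes u: "norm u = 1" and v: "v \<noteq> 0" "u \<bullet> v = 0"
    and B: "\<And>x. x \<in> B \<Longrightarrow> x \<bullet> u = 0" "\<And>x. x \<in> B \<Longrightarrow> x \<bullet> v = 0"
  shows "hausdorff_measure (CARD('n) - 1) B = 0"
proof -
  define C where "C = {x. x \<bullet> u = 0} \<inter> {x. x \<bullet> v = 0}"
  have "closed C"
    unfolding C_def using closed_hyperplane[of u 0] closed_hyperplane[of v 0]
    by (intro closed_Int) (simp_all add: inner_commute)
  obtain m q where m: "m \<noteq> 0" "m \<noteq> top" and prism: "\<And>B. \<lbrakk>B \<in> sets borel; \<And>x. x \<in> B \<Longrightarrow> x \<bullet> u = 0\<rbrakk> \<Longrightarrow>
      hausdorff_measure (CARD('n) - 1) B * m = q * emeasure lborel (prism u B)"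
    using hausdorff_measure_eq_prism[OF u] by blast
  have "x \<bullet> v = 0" if "x \<in> prism u C" for x
    using that v by (simp add: prism_def C_def inner_diff_left)
  then have "prism u C \<subseteq> {x. v \<bullet> x = 0}"
    by (auto simp: inner_commute)
  moreover have "{x. v \<bullet> x = 0} \<in> null_sets lborel"
    using negligible_hyperplane[of v 0] v closed_hyperplane[of v 0]
    by (auto simp: negligible_iff_null_sets null_sets_completion_iff)
  ultimately have "emeasure lborel (prism u C) = 0"
    by (metis emeasure_mono null_setsD1 null_setsD2 le_zero_eq)
  moreover have "hausdorff_measure (CARD('n) - 1) C * m = q * emeasure lborel (prism u C)"
    using \<open>closed C\<close> by (intro prism borel_closed) (auto simp: C_def)
  ultimately have "hausdorff_measure (CARD('n) - 1) C * m = 0"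
    by simp
  then have "hausdorff_measure (CARD('n) - 1) C = 0"
    using m by simp
  moreover have "B \<subseteq> C"
    using B by (auto simp: C_def)
  ultimately show ?thesis
    using hausdorff_measure_mono[of B C "CARD('n) - 1"] by simp
qed

subsection \<open>The surface area measure of a convex body\<close>

definition reverse_gauss :: "(real^'n) set \<Rightarrow> (real^'n) set \<Rightarrow> (real^'n) set" where
  "reverse_gauss K A = {x \<in> frontier K. \<exists>u\<in>A. outer_unit_normal K x u}"

definition singular_points :: "(real^'n) set \<Rightarrow> (real^'n) set" where
  "singular_points K = {x \<in> frontier K. \<exists>u v. outer_unit_normal K x u \<and> outer_unit_normal K x v \<and> u \<noteq> v}"

text \<open>Boundary points with normals near \<open>a\<close> form a Lipschitz graph over \<open>a\<^sup>\<bottom>\<close> with small slope.\<close>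

lemma inner_diff_near_normal:
  assumes "x \<in> K" "y \<in> K" "outer_unit_normal K x u" "outer_unit_normal K y v"
    and "norm (u - a) \<le> \<eta>" "norm (v - a) \<le> \<eta>"
  shows "\<bar>(x - y) \<bullet> a\<bar> \<le> \<eta> * norm (x - y)"
proof -
  have "(y - x) \<bullet> u \<le> 0" "(x - y) \<bullet> v \<le> 0"
    using assms by (auto simp: outer_unit_normal_def)
  moreover have "(x - y) \<bullet> a = - ((y - x) \<bullet> u) - (x - y) \<bullet> (u - a)" "(x - y) \<bullet> a = (x - y) \<bullet> v - (x - y) \<bullet> (v - a)"
    by (simp_all add: inner_diff_left inner_diff_right)
  moreover have "\<bar>(x - y) \<bullet> (u - a)\<bar> \<le> \<eta> * norm (x - y)" "\<bar>(x - y) \<bullet> (v - a)\<bar> \<le> \<eta> * norm (x - y)"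
    using assms(5,6) Cauchy_Schwarz_ineq2[of "x - y" "u - a"] Cauchy_Schwarz_ineq2[of "x - y" "v - a"]
      mult_left_mono[of _ \<eta> "norm (x - y)"] by (auto simp: mult.commute intro: order_trans)
  ultimately show ?thesis
    by linarith
qed

text \<open>The difference of two such points is nearly orthogonal to both \<open>u\<close> and
  \<open>v\<close>, so the projection \<open>P\<close> onto the orthogonal complement of their span
  at most halves it. The projected set has codimension two and is null, and the inverse of the
  projection is Lipschitz.\<close>

lemma two_normals_near_null:
  fixes u v :: "real^'n"
  assumes u: "norm u = 1" and v: "norm v = 1" and "u \<noteq> v" "u \<noteq> - v"
  shows "\<exists>\<eta>>0. \<forall>K::(real^'n) set. hausdorff_measure (CARD('n) - 1) {x \<in> K. \<exists>u' v'. outer_unit_normal K x u' \<and>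
    outer_unit_normal K x v' \<and> norm (u' - u) \<le> \<eta> \<and> norm (v' - v) \<le> \<eta>} = 0"
proof -
  have uu: "u \<bullet> u = 1" and vv: "v \<bullet> v = 1"
    using u v by (auto simp: dot_square_norm)
  \<comment> \<open>Gram-Schmidt: the part of \<open>v\<close> orthogonal to \<open>u\<close>,
    nonzero because the two unit vectors are neither equal nor opposite.\<close>
  define p where "p = v - (u \<bullet> v) *\<^sub>R u"
  have pu: "u \<bullet> p = 0" "p \<bullet> u = 0"
    by (simp_all add: p_def inner_diff_right inner_diff_left uu inner_commute)
  have "p \<noteq> 0"
  proof
    assume "p = 0"
    then have v_eq: "v = (u \<bullet> v) *\<^sub>R u"
      by (simp add: p_def)
    then have "norm v = \<bar>u \<bullet> v\<bar> * norm u"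
      by (metis norm_scaleR)
    then have "u \<bullet> v = 1 \<or> u \<bullet> v = - 1"
      using u v by auto
    then have "v = u \<or> v = - u"
      by (metis v_eq scaleR_one scaleR_minus1_left)
    then show False
      using \<open>u \<noteq> v\<close> \<open>u \<noteq> - v\<close> by auto
  qed
  \<comment> \<open>The components of \<open>d\<close> along \<open>u\<close> and \<open>p\<close>
    have lengths at most \<open>\<eta> * norm d\<close> and
    \<open>2 * \<eta> * norm d / norm p\<close>. With this \<eta> they add up to at most half of
    \<open>norm d\<close>, which is absorbed on the left.\<close>
  define \<eta> where "\<eta> = 1 / (2 * (1 + 2 / norm p))"
  have "\<eta> > 0"
    using \<open>p \<noteq> 0\<close> by (simp add: \<eta>_def add_pos_pos)
  have \<eta>: "\<eta> * (1 + 2 / norm p) = 1 / 2"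
    using \<open>p \<noteq> 0\<close> by (simp add: \<eta>_def field_simps add_nonneg_eq_0_iff)
  define P where "P d = d - (d \<bullet> u) *\<^sub>R u - ((d \<bullet> p) / (p \<bullet> p)) *\<^sub>R p" for d
  have P_diff: "P x - P y = P (x - y)" for x y
    by (simp add: P_def inner_diff_left diff_divide_distrib algebra_simps)
  have P_bound: "norm d \<le> 2 * norm (P d)" if du: "\<bar>d \<bullet> u\<bar> \<le> \<eta> * norm d" and dv: "\<bar>d \<bullet> v\<bar> \<le> \<eta> * norm d" for d
  proof -
    have "\<bar>u \<bullet> v\<bar> \<le> 1"
      using Cauchy_Schwarz_ineq2[of u v] u v by simp
    then have "\<bar>(u \<bullet> v) * (d \<bullet> u)\<bar> \<le> 1 * \<bar>d \<bullet> u\<bar>"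
      unfolding abs_mult by (rule mult_right_mono) simp
    then have "\<bar>d \<bullet> p\<bar> \<le> 2 * (\<eta> * norm d)"
      using du dv by (simp add: p_def inner_diff_right)
    then have "\<bar>d \<bullet> p\<bar> / norm p \<le> 2 * (\<eta> * norm d) / norm p"
      by (rule divide_right_mono) simp
    moreover have "norm (((d \<bullet> p) / (p \<bullet> p)) *\<^sub>R p) = \<bar>d \<bullet> p\<bar> / norm p"
      using \<open>p \<noteq> 0\<close> by (simp add: dot_square_norm power2_eq_square)
    moreover have "norm ((d \<bullet> u) *\<^sub>R u) = \<bar>d \<bullet> u\<bar>"
      using u by simp
    moreover have "d = P d + (d \<bullet> u) *\<^sub>R u + ((d \<bullet> p) / (p \<bullet> p)) *\<^sub>R p"
      by (simp add: P_def)
    then have "norm d \<le> norm (P d) + norm ((d \<bullet> u) *\<^sub>R u) + norm (((d \<bullet> p) / (p \<bullet> p)) *\<^sub>R p)"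
      using norm_triangle_ineq order_trans by (metis (no_types, opaque_lifting) add_right_mono)
    ultimately have "norm d \<le> norm (P d) + \<eta> * norm d + 2 * (\<eta> * norm d) / norm p"
      using du by linarith
    also have "\<dots> = norm (P d) + (\<eta> * (1 + 2 / norm p)) * norm d"
      by (simp add: algebra_simps)
    finally show ?thesis
      unfolding \<eta> by simp
  qed
  have "hausdorff_measure (CARD('n) - 1) {x \<in> K. \<exists>u' v'. outer_unit_normal K x u' \<and>
    outer_unit_normal K x v' \<and> norm (u' - u) \<le> \<eta> \<and> norm (v' - v) \<le> \<eta>} = 0" (is "hausdorff_measure ?d ?C = 0")
    for K :: "(real^'n) set"
  proof -
    have "hausdorff_measure ?d ((\<lambda>x. x) ` ?C) \<le> ennreal (2 ^ ?d) * hausdorff_measure ?d (P ` ?C)"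
    proof (rule hausdorff_measure_image_le)
      fix x y assume "x \<in> ?C" "y \<in> ?C"
      then have "norm (x - y) \<le> 2 * norm (P (x - y))"
        by (intro P_bound) (auto intro: inner_diff_near_normal)
      then show "dist x y \<le> 2 * dist (P x) (P y)"
        by (simp add: dist_norm P_diff)
    qed simp
    moreover have "hausdorff_measure ?d (P ` ?C) = 0"
      by (rule hausdorff_measure_codim2_null[OF u \<open>p \<noteq> 0\<close> pu(1)])
        (auto simp: P_def inner_diff_left uu pu \<open>p \<noteq> 0\<close>)
    ultimately show ?thesis
      by simp
  qed
  then show ?thesis
    using \<open>\<eta> > 0\<close> by blast
qed

lemma frontier_subset_convex_body: "convex_body K \<Longrightarrow> frontier K \<subseteq> K"
  by (rule frontier_subset_closed[OF compact_imp_closed]) (simp add: convex_body_def)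

text \<open>Opposite normals at one point would squeeze \<open>K\<close> into a hyperplane, which
  has empty interior.\<close>

lemma not_opposite_normals:
  assumes "convex_body K" "outer_unit_normal K x u" "outer_unit_normal K x v"
  shows "u \<noteq> - v"
proof
  assume "u = - v"
  then have "(y - x) \<bullet> v = 0" if "y \<in> K" for y
    using assms(2,3) that by (fastforce simp: outer_unit_normal_def)
  then have "K \<subseteq> {y. v \<bullet> y = v \<bullet> x}"
    by (auto simp: inner_diff_left inner_commute[of v])
  then have "interior K \<subseteq> interior {y. v \<bullet> y = v \<bullet> x}"
    by (rule interior_mono)
  moreover have "v \<noteq> 0"
    using assms(3) by (auto simp: outer_unit_normal_def)
  ultimately show False
    using assms(1) by (simp add: convex_body_def)
qed

text \<open>Every admissible pair of directions has an open neighbourhood such that the points with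
  a pair of normals in it form a null set. By Lindelof's theorem countably many of these
  neighbourhoods cover all pairs.\<close>

lemma singular_points_null:
  fixes K :: "(real^'n) set"
  assumes "convex_body K"
  shows "hausdorff_measure (CARD('n) - 1) (singular_points K) = 0"
proof -
  define W where "W = {(u, v). norm u = 1 \<and> norm v = 1 \<and> u \<noteq> v \<and> u \<noteq> - (v::real^'n)}"
  define C where "C G = {x \<in> K. \<exists>(u, v)\<in>G. outer_unit_normal K x u \<and> outer_unit_normal K x v}" for G
  have "\<exists>G. open G \<and> w \<in> G \<and> hausdorff_measure (CARD('n) - 1) (C G) = 0" if w: "w \<in> W" for w
  proof -
    obtain u v where w_eq: "w = (u, v)" and uv: "norm u = 1" "norm v = 1" "u \<noteq> v" "u \<noteq> - v"
      using w by (cases w) (auto simp: W_def)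
    obtain \<eta> where "\<eta> > 0" and null: "hausdorff_measure (CARD('n) - 1) {x \<in> K. \<exists>u' v'. outer_unit_normal K x u' \<and>
        outer_unit_normal K x v' \<and> norm (u' - u) \<le> \<eta> \<and> norm (v' - v) \<le> \<eta>} = 0"
      using two_normals_near_null[OF uv] by blast
    have "C (ball u \<eta> \<times> ball v \<eta>) \<subseteq> {x \<in> K. \<exists>u' v'. outer_unit_normal K x u' \<and>
        outer_unit_normal K x v' \<and> norm (u' - u) \<le> \<eta> \<and> norm (v' - v) \<le> \<eta>}"
    proof
      fix x assume "x \<in> C (ball u \<eta> \<times> ball v \<eta>)"
      then obtain u' v' where "x \<in> K" "outer_unit_normal K x u'" "outer_unit_normal K x v'"
        and "norm (u - u') < \<eta>" "norm (v - v') < \<eta>"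
        by (auto simp: C_def dist_norm)
      moreover from this have "norm (u' - u) \<le> \<eta>" "norm (v' - v) \<le> \<eta>"
        by (simp_all add: norm_minus_commute)
      ultimately show "x \<in> {x \<in> K. \<exists>u' v'. outer_unit_normal K x u' \<and>
        outer_unit_normal K x v' \<and> norm (u' - u) \<le> \<eta> \<and> norm (v' - v) \<le> \<eta>}"
        by blast
    qed
    then have "hausdorff_measure (CARD('n) - 1) (C (ball u \<eta> \<times> ball v \<eta>)) \<le> 0"
      unfolding null[symmetric] by (rule hausdorff_measure_mono)
    then show ?thesis
      using w_eq \<open>\<eta> > 0\<close> by (intro exI[of _ "ball u \<eta> \<times> ball v \<eta>"]) (auto intro: open_Times)
  qed
  then obtain G where G: "\<And>w. w \<in> W \<Longrightarrow> open (G w)" "\<And>w. w \<in> W \<Longrightarrow> w \<in> G w"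
      "\<And>w. w \<in> W \<Longrightarrow> hausdorff_measure (CARD('n) - 1) (C (G w)) = 0"
    by metis
  obtain F where F: "F \<subseteq> G ` W" "countable F" "\<Union>F = \<Union>(G ` W)"
    using Lindelof[of "G ` W"] G(1) by blast
  have "singular_points K \<subseteq> (\<Union>S\<in>F. C S)"
  proof
    fix x assume "x \<in> singular_points K"
    then obtain u v where uv: "x \<in> frontier K" "outer_unit_normal K x u" "outer_unit_normal K x v" "u \<noteq> v"
      by (auto simp: singular_points_def)
    then have "(u, v) \<in> W"
      using not_opposite_normals[OF assms] by (auto simp: W_def outer_unit_normal_def)
    then have "(u, v) \<in> \<Union>F"
      unfolding F(3) using G(2) by blast
    then show "x \<in> (\<Union>S\<in>F. C S)"
      using uv frontier_subset_convex_body[OF assms] by (auto simp: C_def)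
  qed
  moreover have "hausdorff_measure (CARD('n) - 1) (\<Union>S\<in>F. C S) = 0"
    using F G(3) by (intro hausdorff_measure_countable_null) auto
  ultimately show ?thesis
    using hausdorff_measure_mono by (metis le_zero_eq)
qed

section \<open>Countable additivity of the surface area measure\<close>

lemma hausdorff_null_lambda:
  fixes N :: "'a::metric_space set"
  assumes "hausdorff_measure k N = 0" "M \<subseteq> N"
  shows "M \<in> lambda_system UNIV UNIV (hausdorff_measure k)"
proof -
  interpret sigma_algebra "UNIV :: 'a set" UNIV
    using sigma_algebra_Pow[of "UNIV :: 'a set"] by simp
  have "hausdorff_measure k (X \<inter> M) + hausdorff_measure k (X - M) = hausdorff_measure k X" for X
  proof (rule antisym)
    have "hausdorff_measure k (X \<inter> M) = 0"
      using hausdorff_measure_mono[of "X \<inter> M" N k] assms by (metis Int_lower2 le_zero_eq order_trans)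
    then show "hausdorff_measure k (X \<inter> M) + hausdorff_measure k (X - M) \<le> hausdorff_measure k X"
      by (simp add: hausdorff_measure_mono)
    have "(X \<inter> M) \<union> (X - M) = X"
      by auto
    then show "hausdorff_measure k X \<le> hausdorff_measure k (X \<inter> M) + hausdorff_measure k (X - M)"
      by (metis hausdorff_measure_Un_le)
  qed
  then show ?thesis
    by (simp add: lambda_system_eq)
qed

text \<open>The set is the projection of the compact set \<open>Z\<close> of pairs of a boundary
  point and a unit normal there belonging to \<open>C\<close>.\<close>

lemma closed_reverse_gauss:
  fixes K :: "(real^'n) set"
  assumes "compact K" "closed C"
  shows "closed (reverse_gauss K C)"
proof -
  define Z where "Z = (frontier K \<times> (C \<inter> sphere 0 1)) \<inter> (\<Inter>y\<in>K. {z. (y - fst z) \<bullet> snd z \<le> 0})"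
  have "closed {z::(real^'n) \<times> (real^'n). (y - fst z) \<bullet> snd z \<le> 0}" for y
    by (intro closed_Collect_le continuous_intros)
  moreover have "compact (frontier K \<times> (C \<inter> sphere 0 1))"
    using assms by (intro compact_Times compact_frontier closed_Int_compact) auto
  ultimately have "compact Z"
    unfolding Z_def by (intro compact_Int_closed closed_INT) auto
  then have "compact (fst ` Z)"
    by (intro compact_continuous_image continuous_on_fst continuous_on_id)
  moreover have "fst ` Z = reverse_gauss K C"
  proof (intro set_eqI iffI)
    fix x assume "x \<in> reverse_gauss K C"
    then obtain u where "u \<in> C" "x \<in> frontier K" "outer_unit_normal K x u"
      by (auto simp: reverse_gauss_def)
    then have "(x, u) \<in> Z"
      by (auto simp: Z_def outer_unit_normal_def)
    then show "x \<in> fst ` Z"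
      by force
  qed (auto simp: Z_def reverse_gauss_def outer_unit_normal_def)
  ultimately show ?thesis
    by (simp add: compact_imp_closed)
qed

lemma reverse_gauss_lambda:
  fixes K :: "(real^'n) set"
  assumes K: "convex_body K" and A: "A \<in> sets borel"
  shows "reverse_gauss K A \<in> lambda_system UNIV UNIV (hausdorff_measure (CARD('n) - 1))"
proof -
  let ?L = "lambda_system UNIV UNIV (hausdorff_measure (CARD('n) - 1)) :: (real^'n) set set"
  interpret L: sigma_algebra UNIV ?L
    using measure_space_hausdorff_lambda by (auto simp: measure_space_def)
  have closed: "reverse_gauss K C \<in> ?L" if "closed C" for C
    using that K by (intro hausdorff_measure_borel_lambda borel_closed closed_reverse_gauss) (auto simp: convex_body_def)
  \<comment> \<open>The points with a normal in \<open>A\<close> and those with a normal in the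
    complement can overlap, but only in singular points. The correction is a subset of a null set,
    hence Caratheodory measurable whether or not it is Borel.\<close>
  have Compl: "reverse_gauss K (- A) \<in> ?L" if "reverse_gauss K A \<in> ?L" for A
  proof -
    have "reverse_gauss K (- A) \<inter> singular_points K \<in> ?L"
      by (rule hausdorff_null_lambda[OF singular_points_null[OF K]]) auto
    then have "(reverse_gauss K UNIV - reverse_gauss K A) \<union> (reverse_gauss K (- A) \<inter> singular_points K) \<in> ?L"
      using that closed[of UNIV] by (intro L.Un L.Diff) auto
    also have "(reverse_gauss K UNIV - reverse_gauss K A) \<union> (reverse_gauss K (- A) \<inter> singular_points K) = reverse_gauss K (- A)"
      by (auto simp: reverse_gauss_def singular_points_def)
    finally show ?thesis .
  qed
  have "A \<in> sigma_sets UNIV {S. open S}"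
    using A by (simp add: borel_def)
  then show ?thesis
  proof induction
    case (Basic S)
    then show ?case
      using Compl[OF closed[of "- S"]] by (simp add: closed_Compl)
  next
    case Empty
    then show ?case
      using closed[of "{}"] by simp
  next
    case (Compl A)
    then show ?case
      using \<open>\<And>A. reverse_gauss K A \<in> ?L \<Longrightarrow> reverse_gauss K (- A) \<in> ?L\<close> by (simp add: Compl_eq_Diff_UNIV)
  next
    case (Union A)
    moreover have "reverse_gauss K (\<Union>i. A i) = (\<Union>i. reverse_gauss K (A i))"
      by (auto simp: reverse_gauss_def)
    ultimately show ?case
      by (metis L.countable_UN image_subsetI)
  qed
qed

lemma sets_surface_area_measure [simp, measurable_cong]:
  "sets (surface_area_measure K) = sets (restrict_space borel (sphere 0 1))"
  unfolding surface_area_measure_def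
  using sets.sets_measure_of_eq[of "restrict_space borel (sphere 0 1 :: (real^'a) set)"] by (simp add: space_restrict_space)

lemma space_surface_area_measure [simp]: "space (surface_area_measure K) = sphere 0 1"
  using sets_eq_imp_space_eq[OF sets_surface_area_measure[of K]] by (simp add: space_restrict_space)

lemma sets_sphere_iff: "(A :: (real^'n) set) \<in> sets (restrict_space borel (sphere 0 1)) \<longleftrightarrow> A \<in> sets borel \<and> A \<subseteq> sphere 0 1"
  by (subst sets_restrict_space_iff) (auto intro: borel_closed)

text \<open>The value can be read off \<open>measure_of\<close> only after proving countable
  additivity. Disjoint sets of normals belong to sets of boundary points that overlap in singular
  points alone; once this null set is removed, additivity is that of Hausdorff measure.\<close>

lemma emeasure_surface_area_measure:
  fixes K :: "(real^'n) set"
  assumes K: "convex_body K" and A: "A \<in> sets borel" "A \<subseteq> sphere 0 1"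
  shows "emeasure (surface_area_measure K) A = hausdorff_measure (CARD('n) - 1) (reverse_gauss K A)"
proof -
  let ?H = "hausdorff_measure (CARD('n) - 1) :: (real^'n) set \<Rightarrow> ennreal"
  let ?L = "lambda_system UNIV UNIV ?H"
  let ?S = "restrict_space borel (sphere 0 1 :: (real^'n) set)"
  interpret L: sigma_algebra UNIV ?L
    using measure_space_hausdorff_lambda by (auto simp: measure_space_def)
  let ?N = "singular_points K"
  have N: "?H ?N = 0"
    by (rule singular_points_null[OF K])
  have diff_N: "?H (X - ?N) = ?H X" for X
  proof (rule antisym)
    have "?H X \<le> ?H ((X - ?N) \<union> ?N)"
      by (intro hausdorff_measure_mono) auto
    also have "\<dots> \<le> ?H (X - ?N) + ?H ?N"
      by (rule hausdorff_measure_Un_le)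
    finally show "?H X \<le> ?H (X - ?N)"
      unfolding N by simp
  qed (auto intro: hausdorff_measure_mono)
  have ca: "countably_additive (sets ?S) (\<lambda>A. ?H (reverse_gauss K A))"
    unfolding countably_additive_def
  proof (intro allI impI)
    fix A :: "nat \<Rightarrow> (real^'n) set"
    assume A: "range A \<subseteq> sets ?S" "disjoint_family A"
    define E where "E i = reverse_gauss K (A i) - ?N" for i
    have "A i \<in> sets borel" for i
      using A(1) sets_sphere_iff[of "A i"] by auto
    then have E: "range E \<subseteq> ?L"
      unfolding E_def using L.Diff[OF reverse_gauss_lambda[OF K] hausdorff_null_lambda[OF N order_refl]]
      by blast
    have "E i \<inter> E j = {}" if "i \<noteq> j" for i j
    proof (rule ccontr)
      assume "E i \<inter> E j \<noteq> {}"
      then obtain x u v where x: "x \<in> frontier K" "x \<notin> ?N" "u \<in> A i" "v \<in> A j"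
          "outer_unit_normal K x u" "outer_unit_normal K x v"
        by (auto simp: E_def reverse_gauss_def)
      moreover have "A i \<inter> A j = {}"
        using A(2) that by (auto simp: disjoint_family_on_def)
      ultimately have "x \<in> ?N"
        unfolding singular_points_def by blast
      then show False
        using x by simp
    qed
    then have "disjoint_family E"
      by (simp add: disjoint_family_on_def)
    moreover have "countably_additive ?L ?H"
      using measure_space_hausdorff_lambda by (auto simp: measure_space_def)
    moreover have "(\<Union>i. E i) \<in> ?L"
      using E by (rule L.countable_UN)
    ultimately have "(\<Sum>i. ?H (E i)) = ?H (\<Union>i. E i)"
      using E unfolding countably_additive_def by simp
    moreover have "(\<Union>i. E i) = reverse_gauss K (\<Union>i. A i) - ?N"
      by (auto simp: E_def reverse_gauss_def)
    ultimately show "(\<Sum>i. ?H (reverse_gauss K (A i))) = ?H (reverse_gauss K (\<Union>i. A i))"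
      by (simp only: E_def diff_N)
  qed
  have pos: "positive (sets ?S) (\<lambda>A. ?H (reverse_gauss K A))"
    by (simp add: positive_def reverse_gauss_def)
  have sub: "sets ?S \<subseteq> Pow (sphere 0 1)"
    using sets_sphere_iff by blast
  have eq: "surface_area_measure K = measure_of (sphere 0 1) (sets ?S) (\<lambda>A. ?H (reverse_gauss K A))"
    by (simp add: surface_area_measure_def reverse_gauss_def)
  show ?thesis
  proof (rule emeasure_measure_of[OF eq sub])
    show "A \<in> sets (surface_area_measure K)"
      using A by (simp only: sets_surface_area_measure sets_sphere_iff)
  qed (simp_all only: sets_surface_area_measure pos ca)
qed

subsection \<open>Linear images of convex bodies\<close>

text \<open>\<open>S\<close> is the inverse transpose of \<open>T\<close>: if \<open>u\<close> is normal to \<open>K\<close> at \<open>x\<close>, then \<open>S u\<close> is normal to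
  \<open>T K\<close> at \<open>T x\<close>.\<close>

locale dual_linear_maps =
  fixes T S :: "real^'n \<Rightarrow> real^'n"
  assumes linear_T: "linear T" and bij_T: "bij T" and linear_S: "linear S" and bij_S: "bij S"
    and dual: "T x \<bullet> S y = x \<bullet> y"
begin

text \<open>On the sphere this inverts the map taking \<open>u\<close> to the normalised vector
  \<open>S u\<close>, so it carries unit normals of the image body back to unit normals of
  \<open>K\<close>.\<close>

definition pull_normal :: "real^'n \<Rightarrow> real^'n" where
  "pull_normal v = inv S v /\<^sub>R norm (inv S v)"

lemma linear_inv_S: "linear (inv S)"
  using inj_linear_imp_inv_linear[OF linear_S] bij_is_inj[OF bij_S] by simp

lemma linear_inv_T: "linear (inv T)"
  using inj_linear_imp_inv_linear[OF linear_T] bij_is_inj[OF bij_T] by simp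

lemma S_inv_S [simp]: "S (inv S x) = x" and inv_S_S [simp]: "inv S (S x) = x"
  using bij_S by (simp_all add: bij_is_surj bij_is_inj surj_f_inv_f)

lemma T_inv_T [simp]: "T (inv T x) = x" and inv_T_T [simp]: "inv T (T x) = x"
  using bij_T by (simp_all add: bij_is_surj bij_is_inj surj_f_inv_f)

lemma inverse_maps: "dual_linear_maps (inv T) (inv S)"
proof (rule dual_linear_maps.intro)
  show "inv T x \<bullet> inv S y = x \<bullet> y" for x y
    using dual[of "inv T x" "inv S y"] by simp
qed (simp_all add: linear_inv_T linear_inv_S bij_T bij_S bij_imp_bij_inv)

lemma S_nonzero: "x \<noteq> 0 \<Longrightarrow> S x \<noteq> 0"
  using linear_0[OF linear_inv_S] inv_S_S by metis

lemma inv_S_nonzero: "x \<noteq> 0 \<Longrightarrow> inv S x \<noteq> 0"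
  using linear_0[OF linear_S] S_inv_S by metis

lemma norm_pull_normal:
  assumes "norm v = 1"
  shows "norm (pull_normal v) = 1"
proof -
  have "v \<noteq> 0"
    using assms by auto
  then show ?thesis
    using inv_S_nonzero by (simp add: pull_normal_def)
qed

lemma S_pull_normal:
  assumes "norm v = 1"
  shows "v = S (pull_normal v) /\<^sub>R norm (S (pull_normal v))"
proof -
  have "S (pull_normal v) = v /\<^sub>R norm (inv S v)"
    by (simp add: pull_normal_def linear_scale[OF linear_S])
  moreover have "v \<noteq> 0"
    using assms by auto
  then have "inv S v \<noteq> 0"
    by (rule inv_S_nonzero)
  ultimately show ?thesis
    using assms by simp
qed

lemma inner_T_pull_normal:
  assumes "norm v = 1"
  shows "T x \<bullet> v = (x \<bullet> pull_normal v) / norm (S (pull_normal v))"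
proof -
  have "T x \<bullet> v = T x \<bullet> (S (pull_normal v) /\<^sub>R norm (S (pull_normal v)))"
    using S_pull_normal[OF assms] by simp
  then show ?thesis
    by (simp add: dual divide_inverse_commute)
qed

lemma outer_unit_normal_pull:
  assumes "outer_unit_normal (T ` K) (T x) v"
  shows "outer_unit_normal K x (pull_normal v)"
proof -
  have v: "norm v = 1" and le: "\<And>y. y \<in> K \<Longrightarrow> (T y - T x) \<bullet> v \<le> 0"
    using assms by (auto simp: outer_unit_normal_def)
  have "pull_normal v \<noteq> 0"
    using norm_pull_normal[OF v] by auto
  then have "norm (S (pull_normal v)) > 0"
    using S_nonzero by simp
  moreover have "((y - x) \<bullet> pull_normal v) / norm (S (pull_normal v)) \<le> 0" if "y \<in> K" for y
    using le[OF that] inner_T_pull_normal[OF v, of "y - x"] by (simp add: linear_diff[OF linear_T])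
  ultimately show ?thesis
    by (auto simp: outer_unit_normal_def norm_pull_normal[OF v] divide_le_0_iff)
qed

lemma frontier_image: "frontier (T ` K) = T ` frontier K"
  using bij_is_inj[OF bij_T]
  by (simp add: frontier_def image_set_diff interior_injective_linear_image[OF linear_T]
      closure_injective_linear_image[OF linear_T])

lemma reverse_gauss_image_subset:
  assumes "\<And>v. v \<in> B \<Longrightarrow> pull_normal v \<in> A"
  shows "reverse_gauss (T ` K) B \<subseteq> T ` reverse_gauss K A"
proof
  fix z assume "z \<in> reverse_gauss (T ` K) B"
  then obtain x v where "z = T x" "x \<in> frontier K" "v \<in> B" "outer_unit_normal (T ` K) (T x) v"
    by (auto simp: reverse_gauss_def frontier_image)
  then have "x \<in> reverse_gauss K A"
    using outer_unit_normal_pull assms unfolding reverse_gauss_def by blast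
  then show "z \<in> T ` reverse_gauss K A"
    using \<open>z = T x\<close> by simp
qed

lemma convex_body_image:
  assumes "convex_body K"
  shows "convex_body (T ` K)"
proof -
  have "compact (T ` K)"
    using assms linear_T by (intro compact_continuous_image linear_continuous_on)
      (auto simp: convex_body_def linear_conv_bounded_linear)
  then show ?thesis
    using assms convex_linear_image[OF linear_T] interior_injective_linear_image[OF linear_T bij_is_inj[OF bij_T], of K]
    by (simp add: convex_body_def)
qed

section \<open>Transformation of the surface area measure\<close>

lemma hausdorff_measure_image_reverse_gauss_le:
  assumes K: "convex_body K" and a: "norm a = 1" and A: "\<And>u. u \<in> A \<Longrightarrow> norm (u - a) \<le> \<eta>"
    and C: "\<And>x. norm (T x) \<le> C * norm x" "\<And>x. norm x \<le> C * norm (T x)"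
    and "C > 0" "\<eta> > 0" "C\<^sup>2 * \<eta> < 1"
  shows "hausdorff_measure (CARD('n) - 1) (T ` reverse_gauss K A) \<le>
    ennreal ((1 / (1 - C\<^sup>2 * \<eta>)) ^ (CARD('n) - 1)) * (ennreal (\<bar>det (matrix T)\<bar> * norm (S a)) *
      hausdorff_measure (CARD('n) - 1) (reverse_gauss K A))"
proof -
  let ?H = "hausdorff_measure (CARD('n) - 1) :: (real^'n) set \<Rightarrow> ennreal"
  have aa: "a \<bullet> a = 1"
    using a by (simp add: dot_square_norm)
  define \<tau> where "\<tau> = reverse_gauss K A"
  define \<pi> where "\<pi> x = x - (x \<bullet> a) *\<^sub>R a" for x
  have \<pi>_diff: "\<pi> x - \<pi> y = \<pi> (x - y)" for x y
    by (simp add: \<pi>_def inner_diff_left algebra_simps)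
  have \<pi>_le: "norm (\<pi> x) \<le> norm x" for x
  proof -
    have "(norm (\<pi> x))\<^sup>2 = (norm x)\<^sup>2 - (x \<bullet> a)\<^sup>2"
      unfolding power2_norm_eq_inner
      by (simp add: \<pi>_def inner_diff_left inner_diff_right aa inner_commute power2_eq_square algebra_simps)
    then have "(norm (\<pi> x))\<^sup>2 \<le> (norm x)\<^sup>2"
      by simp
    then show ?thesis
      by (rule power2_le_imp_le) simp
  qed
  have "\<tau> \<subseteq> K"
    using frontier_subset_convex_body[OF K] by (auto simp: \<tau>_def reverse_gauss_def)
  have slope: "\<bar>(x - y) \<bullet> a\<bar> \<le> \<eta> * norm (x - y)" if xy: "x \<in> \<tau>" "y \<in> \<tau>" for x y
  proof -
    obtain u v where "u \<in> A" "v \<in> A" "outer_unit_normal K x u" "outer_unit_normal K y v"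
      using xy by (auto simp: \<tau>_def reverse_gauss_def)
    then show ?thesis
      using xy \<open>\<tau> \<subseteq> K\<close> A by (intro inner_diff_near_normal[of x K y u v]) auto
  qed
  have "bounded K"
    using K by (simp add: convex_body_def compact_imp_bounded)
  then obtain r where r: "\<And>x. x \<in> K \<Longrightarrow> norm x \<le> r"
    by (auto simp: bounded_iff)
  have "norm x \<le> r" if "x \<in> \<pi> ` \<tau>" for x
    using that r \<open>\<tau> \<subseteq> K\<close> \<pi>_le by (blast intro: order_trans)
  then have bounded: "bounded (\<pi> ` \<tau>)"
    by (auto simp: bounded_iff)
  \<comment> \<open>Three comparisons follow one another: the curved piece is replaced by its
    projection before \<open>T\<close> is applied, the linear rule is used on the flat set, and the
    flat set has no more area than the piece because \<pi> does not increase distances.\<close>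
  have "?H (T ` \<tau>) \<le> ennreal ((1 / (1 - C\<^sup>2 * \<eta>)) ^ (CARD('n) - 1)) * ?H ((\<lambda>x. T (\<pi> x)) ` \<tau>)"
  proof (rule hausdorff_measure_image_le)
    fix x y assume xy: "x \<in> \<tau>" "y \<in> \<tau>"
    define d where "d = x - y"
    \<comment> \<open>The height difference is at most \<open>\<eta> * norm d\<close>. Applying
      \<open>T\<close> costs one factor \<open>C\<close>, and returning from \<open>norm d\<close>
      to \<open>norm (T d)\<close> costs another; the error
      \<open>C\<^sup>2 * \<eta> * norm (T d)\<close> is absorbed on the left.\<close>
    have "norm (T d) \<le> norm (T (\<pi> d)) + norm (T ((d \<bullet> a) *\<^sub>R a))"
      using norm_triangle_ineq[of "T (\<pi> d)" "T ((d \<bullet> a) *\<^sub>R a)"]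
      by (simp add: \<pi>_def flip: linear_add[OF linear_T])
    also have "norm (T ((d \<bullet> a) *\<^sub>R a)) \<le> C * \<bar>d \<bullet> a\<bar>"
      using C(1)[of "(d \<bullet> a) *\<^sub>R a"] a by simp
    also have "C * \<bar>d \<bullet> a\<bar> \<le> C * (\<eta> * norm d)"
      using slope[OF xy] \<open>C > 0\<close> by (simp add: d_def)
    also have "C * (\<eta> * norm d) \<le> C * (\<eta> * (C * norm (T d)))"
      using C(2)[of d] \<open>C > 0\<close> \<open>\<eta> > 0\<close> by simp
    finally have "(1 - C\<^sup>2 * \<eta>) * norm (T d) \<le> norm (T (\<pi> d))"
      by (simp add: power2_eq_square algebra_simps)
    then have "norm (T d) \<le> 1 / (1 - C\<^sup>2 * \<eta>) * norm (T (\<pi> d))"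
      using \<open>C\<^sup>2 * \<eta> < 1\<close> by (simp add: field_simps)
    then show "dist (T x) (T y) \<le> 1 / (1 - C\<^sup>2 * \<eta>) * dist (T (\<pi> x)) (T (\<pi> y))"
      by (simp add: dist_norm d_def \<pi>_diff flip: linear_diff[OF linear_T])
  qed (use \<open>C\<^sup>2 * \<eta> < 1\<close> in simp)
  also have "?H ((\<lambda>x. T (\<pi> x)) ` \<tau>) = ?H (T ` \<pi> ` \<tau>)"
    by (simp add: image_image)
  also have "\<dots> \<le> ennreal (\<bar>det (matrix T)\<bar> * norm (S a)) * ?H (\<pi> ` \<tau>)"
    using bounded by (intro hausdorff_measure_linear_image_le linear_T bij_T dual a)
      (auto simp: \<pi>_def inner_diff_left aa)
  also have "?H (\<pi> ` \<tau>) \<le> ennreal (1 ^ (CARD('n) - 1)) * ?H ((\<lambda>x. x) ` \<tau>)"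
    using \<pi>_le by (intro hausdorff_measure_image_le) (simp_all add: dist_norm \<pi>_diff)
  finally show ?thesis
    unfolding \<tau>_def by (simp add: mult_left_mono)
qed

lemma pull_normal_measurable [measurable]:
  "pull_normal \<in> surface_area_measure K' \<rightarrow>\<^sub>M surface_area_measure K"
proof -
  have "continuous_on UNIV (inv S)"
    using linear_inv_S by (simp add: linear_continuous_on linear_conv_bounded_linear)
  then have "inv S \<in> borel_measurable borel"
    by (rule borel_measurable_continuous_onI)
  then have "pull_normal \<in> borel_measurable borel"
    unfolding pull_normal_def by measurable
  then have "pull_normal \<in> restrict_space borel (sphere 0 1) \<rightarrow>\<^sub>M restrict_space borel (sphere 0 1)"
    by (intro measurable_restrict_space2 measurable_restrict_space1)
      (auto simp: space_restrict_space norm_pull_normal)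
  then show ?thesis
    by (simp cong: measurable_cong_sets)
qed

definition area_density :: "real^'n \<Rightarrow> real" where
  "area_density u = \<bar>det (matrix T)\<bar> * norm (S u)"

lemma area_density_nonneg [simp]: "0 \<le> area_density u"
  by (simp add: area_density_def)

lemma area_density_measurable [measurable]: "area_density \<in> borel_measurable (surface_area_measure K)"
proof -
  have "continuous_on UNIV S"
    using linear_S by (simp add: linear_continuous_on linear_conv_bounded_linear)
  then have "S \<in> borel_measurable borel"
    by (rule borel_measurable_continuous_onI)
  then have "area_density \<in> borel_measurable borel"
    unfolding area_density_def by measurable
  then show ?thesis
    by (simp add: measurable_restrict_space1 cong: measurable_cong_sets)
qed

text \<open>On a patch of normals within \<eta> of \<open>a\<close>, the flattening estimate
  produces the density at the centre \<open>a\<close>. Replacing it by the density at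
  \<open>u\<close> under the integral costs the additional factor
  \<open>1 + C\<^sup>2 * \<eta>\<close>.\<close>

lemma emeasure_pull_normal_local_le:
  assumes K: "convex_body K" and a: "norm a = 1"
    and A: "A \<in> sets (surface_area_measure K)" "A \<subseteq> cball a \<eta>"
    and C: "\<And>x. norm (T x) \<le> C * norm x" "\<And>x. norm x \<le> C * norm (T x)"
      "\<And>x. norm (S x) \<le> C * norm x" "\<And>x. norm x \<le> C * norm (S x)"
    and "C > 0" "\<eta> > 0" "C\<^sup>2 * \<eta> < 1"
  shows "emeasure (distr (surface_area_measure (T ` K)) (surface_area_measure K) pull_normal) A \<le>
    ennreal ((1 / (1 - C\<^sup>2 * \<eta>)) ^ (CARD('n) - 1) * (1 + C\<^sup>2 * \<eta>)) *
      emeasure (density (surface_area_measure K) area_density) A"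
proof -
  let ?H = "hausdorff_measure (CARD('n) - 1) :: (real^'n) set \<Rightarrow> ennreal"
  let ?c = "(1 / (1 - C\<^sup>2 * \<eta>)) ^ (CARD('n) - 1)"
  note A(1)[measurable]
  have "A \<in> sets borel" and A1: "A \<subseteq> sphere 0 1"
    using A(1) sets_sphere_iff[of A] by auto
  define B where "B = pull_normal -` A \<inter> sphere 0 1"
  have "B \<in> sets (surface_area_measure (T ` K))"
    using measurable_sets[OF pull_normal_measurable A(1)] by (simp add: B_def)
  then have B: "B \<in> sets borel" "B \<subseteq> sphere 0 1"
    using sets_sphere_iff[of B] by auto
  have "emeasure (distr (surface_area_measure (T ` K)) (surface_area_measure K) pull_normal) A =
      emeasure (surface_area_measure (T ` K)) B"
    using A(1) by (simp add: emeasure_distr B_def)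
  also have "\<dots> = ?H (reverse_gauss (T ` K) B)"
    by (rule emeasure_surface_area_measure[OF convex_body_image[OF K] B])
  also have "\<dots> \<le> ?H (T ` reverse_gauss K A)"
    by (intro hausdorff_measure_mono reverse_gauss_image_subset) (simp add: B_def)
  also have "\<dots> \<le> ennreal ?c * (ennreal (area_density a) * ?H (reverse_gauss K A))"
    unfolding area_density_def using A(2) C
    by (intro hausdorff_measure_image_reverse_gauss_le K a \<open>C > 0\<close> \<open>\<eta> > 0\<close> \<open>C\<^sup>2 * \<eta> < 1\<close>)
      (auto simp: dist_norm norm_minus_commute)
  also have "?H (reverse_gauss K A) = emeasure (surface_area_measure K) A"
    by (rule emeasure_surface_area_measure[OF K \<open>A \<in> sets borel\<close> A1, symmetric])
  also have "ennreal (area_density a) * emeasure (surface_area_measure K) A =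
      (\<integral>\<^sup>+ u. ennreal (area_density a) * indicator A u \<partial>surface_area_measure K)"
    using A(1) by (simp add: nn_integral_cmult_indicator)
  also have "\<dots> \<le> (\<integral>\<^sup>+ u. ennreal (1 + C\<^sup>2 * \<eta>) * (ennreal (area_density u) * indicator A u) \<partial>surface_area_measure K)"
  proof (rule nn_integral_mono)
    fix u
    have "area_density a \<le> (1 + C\<^sup>2 * \<eta>) * area_density u" if "u \<in> A"
    proof -
      have "norm (a - u) \<le> \<eta>" "norm u = 1"
        using that A(2) A1 by (auto simp: dist_norm)
      have "S a = S u + S (a - u)"
        by (simp add: linear_diff[OF linear_S])
      then have "norm (S a) \<le> norm (S u) + norm (S (a - u))"
        using norm_triangle_ineq[of "S u" "S (a - u)"] by simp
      also have "norm (S (a - u)) \<le> C * \<eta>"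
        using C(3)[of "a - u"] \<open>norm (a - u) \<le> \<eta>\<close> \<open>C > 0\<close> by (meson mult_left_mono less_imp_le order_trans)
      \<comment> \<open>Since \<open>u\<close> is a unit vector,
        \<open>1 \<le> C * norm (S u)\<close>; this turns the additive error into a multiple of
        \<open>norm (S u)\<close>.\<close>
      also have "C * \<eta> \<le> C * \<eta> * (C * norm (S u))"
        using C(4)[of u] \<open>norm u = 1\<close> \<open>C > 0\<close> \<open>\<eta> > 0\<close> mult_left_mono[of 1 "C * norm (S u)" "C * \<eta>"] by simp
      finally have "norm (S a) \<le> (1 + C\<^sup>2 * \<eta>) * norm (S u)"
        by (simp add: power2_eq_square algebra_simps)
      then have "\<bar>det (matrix T)\<bar> * norm (S a) \<le> \<bar>det (matrix T)\<bar> * ((1 + C\<^sup>2 * \<eta>) * norm (S u))"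
        by (rule mult_left_mono) simp
      then show ?thesis
        by (simp add: area_density_def mult.left_commute)
    qed
    moreover have "0 \<le> 1 + C\<^sup>2 * \<eta>"
      using \<open>\<eta> > 0\<close> by simp
    ultimately show "ennreal (area_density a) * indicator A u \<le>
        ennreal (1 + C\<^sup>2 * \<eta>) * (ennreal (area_density u) * indicator A u)"
      by (auto simp: indicator_def ennreal_leI simp flip: ennreal_mult)
  qed
  also have "\<dots> = ennreal (1 + C\<^sup>2 * \<eta>) * (\<integral>\<^sup>+ u. ennreal (area_density u) * indicator A u \<partial>surface_area_measure K)"
    using A(1) by (intro nn_integral_cmult) measurable
  also have "(\<integral>\<^sup>+ u. ennreal (area_density u) * indicator A u \<partial>surface_area_measure K) =
      emeasure (density (surface_area_measure K) area_density) A"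
    using A(1) by (simp add: emeasure_density)
  finally have "emeasure (distr (surface_area_measure (T ` K)) (surface_area_measure K) pull_normal) A \<le>
      ennreal ?c * (ennreal (1 + C\<^sup>2 * \<eta>) * emeasure (density (surface_area_measure K) area_density) A)"
    by (simp add: mult_left_mono)
  moreover have "0 \<le> ?c" "0 \<le> 1 + C\<^sup>2 * \<eta>"
    using \<open>C\<^sup>2 * \<eta> < 1\<close> \<open>\<eta> > 0\<close> by auto
  ultimately show ?thesis
    by (simp add: ennreal_mult mult.assoc)
qed

lemma distortion_bound:
  obtains C where "C > 0" "\<And>x. norm (T x) \<le> C * norm x" "\<And>x. norm x \<le> C * norm (T x)"
    "\<And>x. norm (S x) \<le> C * norm x" "\<And>x. norm x \<le> C * norm (S x)"
proof -
  obtain a where a: "a > 0" "\<And>x. norm (T x) \<le> a * norm x"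
    using linear_bounded_pos[OF linear_T] by blast
  obtain b where b: "b > 0" "\<And>x. norm (inv T x) \<le> b * norm x"
    using linear_bounded_pos[OF linear_inv_T] by blast
  obtain c where c: "c > 0" "\<And>x. norm (S x) \<le> c * norm x"
    using linear_bounded_pos[OF linear_S] by blast
  obtain d where d: "d > 0" "\<And>x. norm (inv S x) \<le> d * norm x"
    using linear_bounded_pos[OF linear_inv_S] by blast
  show thesis
  proof
    show "a + b + c + d > 0"
      using a b c d by simp
    fix x
    have le: "t * norm y \<le> (a + b + c + d) * norm y" if "t \<in> {a, b, c, d}" for t and y :: "real^'n"
      using that a(1) b(1) c(1) d(1) by (intro mult_right_mono) auto
    show "norm (T x) \<le> (a + b + c + d) * norm x" "norm (S x) \<le> (a + b + c + d) * norm x"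
      using a(2)[of x] c(2)[of x] le[of a x] le[of c x] by auto
    show "norm x \<le> (a + b + c + d) * norm (T x)" "norm x \<le> (a + b + c + d) * norm (S x)"
      using b(2)[of "T x"] d(2)[of "S x"] le[of b "T x"] le[of d "S x"] by auto
  qed
qed

text \<open>The local bound is summed over a finite cover of the sphere by balls of radius \<eta>.
  Its factor is the same on every patch, so it survives the summation, and it tends to 1 with
  \<eta>.\<close>

lemma distr_pull_normal_le:
  assumes K: "convex_body K"
  shows "distr (surface_area_measure (T ` K)) (surface_area_measure K) pull_normal \<le>
    density (surface_area_measure K) area_density" (is "?N \<le> ?D")
proof -
  obtain C where C: "C > 0" "\<And>x. norm (T x) \<le> C * norm x" "\<And>x. norm x \<le> C * norm (T x)"
    "\<And>x. norm (S x) \<le> C * norm x" "\<And>x. norm x \<le> C * norm (S x)"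
    using distortion_bound by blast
  define \<rho> where "\<rho> \<eta> = (1 / (1 - C\<^sup>2 * \<eta>)) ^ (CARD('n) - 1) * (1 + C\<^sup>2 * \<eta>)" for \<eta>
  have upto_\<rho>: "emeasure ?N A \<le> ennreal (\<rho> \<eta>) * emeasure ?D A"
    if A: "A \<in> sets (surface_area_measure K)" and \<eta>: "\<eta> > 0" "C\<^sup>2 * \<eta> < 1" for A \<eta>
  proof -
    have "sphere (0::real^'n) 1 \<subseteq> (\<Union>x\<in>sphere 0 1. ball x \<eta>)"
      using \<eta>(1) by auto
    then obtain F where F: "F \<subseteq> sphere (0::real^'n) 1" "finite F" "sphere 0 1 \<subseteq> (\<Union>x\<in>F. ball x \<eta>)"
      by (rule compactE_image[OF compact_sphere open_ball])
    have cover: "A \<subseteq> (\<Union>x\<in>F. cball x \<eta>)"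
    proof
      fix x assume "x \<in> A"
      then have "x \<in> (\<Union>x\<in>F. ball x \<eta>)"
        using sets.sets_into_space[OF A] F(3) by (simp only: space_surface_area_measure subset_iff)
      then show "x \<in> (\<Union>x\<in>F. cball x \<eta>)"
        using ball_subset_cball by blast
    qed
    show ?thesis
      using F(2) cover F(1) A
    proof (induction F arbitrary: A rule: finite_induct)
      \<comment> \<open>The patches are removed from \<open>A\<close> one at a time; this keeps the
        summed pieces disjoint although the balls overlap.\<close>
      case (insert a F)
      have cball: "cball a \<eta> \<inter> sphere 0 1 \<in> sets (surface_area_measure K)"
        by (simp only: sets_surface_area_measure sets_sphere_iff) (auto intro: borel_closed)
      have "A \<inter> (cball a \<eta> \<inter> sphere 0 1) = A \<inter> cball a \<eta>"
        using sets.sets_into_space[OF insert.prems(3)] by auto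
      then have 1: "A \<inter> cball a \<eta> \<in> sets (surface_area_measure K)"
        using sets.Int[OF insert.prems(3) cball] by simp
      then have 2: "A - A \<inter> cball a \<eta> \<in> sets (surface_area_measure K)"
        using insert.prems(3) by blast
      have split: "emeasure M A = emeasure M (A \<inter> cball a \<eta>) + emeasure M (A - A \<inter> cball a \<eta>)"
        if "sets M = sets (surface_area_measure K)" for M
        using 1 2 that by (subst plus_emeasure) (auto intro!: arg_cong[of _ _ "emeasure M"])
      have "emeasure ?N (A \<inter> cball a \<eta>) \<le> ennreal (\<rho> \<eta>) * emeasure ?D (A \<inter> cball a \<eta>)"
        unfolding \<rho>_def using insert.prems(2) 1 by (intro emeasure_pull_normal_local_le K C \<eta>) auto
      moreover have "emeasure ?N (A - A \<inter> cball a \<eta>) \<le> ennreal (\<rho> \<eta>) * emeasure ?D (A - A \<inter> cball a \<eta>)"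
        using insert.prems(1,2) by (intro insert.IH 2) auto
      ultimately show ?case
        by (subst (1 2) split) (auto simp: distrib_left intro: add_mono)
    qed auto
  qed
  have "emeasure ?N A \<le> emeasure ?D A" if A: "A \<in> sets (surface_area_measure K)" for A
  proof (cases "emeasure ?D A")
    \<comment> \<open>For an infinite right-hand side the bound is trivial. For a finite one it is a
      real multiple of \<open>d\<close>, and the limit in \<eta> can be taken.\<close>
    case (real d)
    have "C\<^sup>2 > 0"
      using C(1) by simp
    have "((\<lambda>\<eta>. \<rho> \<eta> * d) \<longlongrightarrow> (1 / (1 - C\<^sup>2 * 0)) ^ (CARD('n) - 1) * (1 + C\<^sup>2 * 0) * d) (at_right 0)"
      unfolding \<rho>_def by (intro tendsto_intros) auto
    then have lim: "((\<lambda>\<eta>. ennreal (\<rho> \<eta> * d)) \<longlongrightarrow> ennreal d) (at_right 0)"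
      by (intro tendsto_ennrealI) simp
    have "eventually (\<lambda>\<eta>. \<eta> \<in> {0<..<1 / C\<^sup>2}) (at_right (0::real))"
      using \<open>C\<^sup>2 > 0\<close> by (intro eventually_at_right_real) simp
    then have "eventually (\<lambda>\<eta>. emeasure ?N A \<le> ennreal (\<rho> \<eta> * d)) (at_right 0)"
    proof eventually_elim
      case (elim \<eta>)
      then have \<eta>: "\<eta> > 0" "C\<^sup>2 * \<eta> < 1"
        using \<open>C\<^sup>2 > 0\<close> by (auto simp: field_simps)
      have "0 \<le> \<rho> \<eta>"
        using \<eta> by (simp add: \<rho>_def)
      then show ?case
        using upto_\<rho>[OF A \<eta>] real by (simp add: ennreal_mult)
    qed
    then show ?thesis
      using tendsto_lowerbound[OF lim] real by simp
  qed simp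
  then show ?thesis
    by (subst le_measure) auto
qed

lemma nn_integral_surface_area_image_le:
  assumes K: "convex_body K" and [measurable]: "F \<in> borel_measurable (surface_area_measure K)"
  shows "(\<integral>\<^sup>+ v. F (pull_normal v) \<partial>surface_area_measure (T ` K)) \<le>
    (\<integral>\<^sup>+ u. ennreal (area_density u) * F u \<partial>surface_area_measure K)"
proof -
  have "(\<integral>\<^sup>+ v. F (pull_normal v) \<partial>surface_area_measure (T ` K)) =
      (\<integral>\<^sup>+ u. F u \<partial>distr (surface_area_measure (T ` K)) (surface_area_measure K) pull_normal)"
    by (rule nn_integral_distr[symmetric]) measurable
  also have "\<dots> \<le> (\<integral>\<^sup>+ u. F u \<partial>density (surface_area_measure K) area_density)"
    by (intro nn_integral_mono_measure distr_pull_normal_le K) simp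
  also have "\<dots> = (\<integral>\<^sup>+ u. ennreal (area_density u) * F u \<partial>surface_area_measure K)"
    by (rule nn_integral_density) measurable
  finally show ?thesis .
qed

end

section \<open>Support functions and the L_p mixed volume\<close>

lemma bdd_above_inner_image:
  assumes "compact K" "K \<noteq> {}"
  shows "bdd_above ((\<lambda>x. x \<bullet> u) ` K)"
  using assms by (intro bounded_imp_bdd_above compact_imp_bounded compact_continuous_image continuous_intros)

text \<open>The supremum runs over uncountably many functions, so measurability is obtained from
  continuity: a norm bound for \<open>K\<close> is a Lipschitz constant of the support
  function.\<close>

lemma support_fun_measurable:
  fixes K :: "(real^'n) set"
  assumes "compact K" "K \<noteq> {}"
  shows "support_fun K \<in> borel_measurable borel"
proof -
  obtain r where r: "r > 0" "\<And>x. x \<in> K \<Longrightarrow> norm x \<le> r"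
    using compact_imp_bounded[OF assms(1)] by (auto simp: bounded_pos)
  have le: "support_fun K u \<le> support_fun K v + r * norm (u - v)" for u v
    unfolding support_fun_def
  proof (rule cSUP_least[OF assms(2)])
    fix x assume "x \<in> K"
    have "x \<bullet> (u - v) \<le> norm x * norm (u - v)"
      by (rule norm_cauchy_schwarz)
    also have "\<dots> \<le> r * norm (u - v)"
      using r(2)[OF \<open>x \<in> K\<close>] by (rule mult_right_mono) simp
    moreover have "x \<bullet> v \<le> (SUP x\<in>K. x \<bullet> v)"
      using \<open>x \<in> K\<close> by (rule cSUP_upper) (rule bdd_above_inner_image[OF assms])
    ultimately show "x \<bullet> u \<le> (SUP x\<in>K. x \<bullet> v) + r * norm (u - v)"
      by (simp add: inner_diff_right)
  qed
  have "r-lipschitz_on UNIV (support_fun K)"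
  proof (rule lipschitz_onI)
    fix u v
    show "dist (support_fun K u) (support_fun K v) \<le> r * dist u v"
      using le[of u v] le[of v u] by (simp add: dist_norm norm_minus_commute abs_le_iff)
  qed (use r in simp)
  then show ?thesis
    by (intro borel_measurable_continuous_onI lipschitz_on_continuous_on)
qed

lemma support_fun_nonneg:
  assumes "compact K" "0 \<in> K"
  shows "0 \<le> support_fun K u"
proof -
  have "0 \<bullet> u \<le> (SUP x\<in>K. x \<bullet> u)"
    using assms(2) by (rule cSUP_upper) (rule bdd_above_inner_image, use assms in auto)
  then show ?thesis
    by (simp add: support_fun_def)
qed

definition Lp_integrand :: "real \<Rightarrow> (real^'n) set \<Rightarrow> (real^'n) set \<Rightarrow> real^'n \<Rightarrow> real" where
  "Lp_integrand p K Q u = support_fun Q u powr p * support_fun K u powr (1 - p)"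

lemma bodies0_D:
  assumes "K \<in> bodies0"
  shows "convex_body K" "compact K" "0 \<in> interior K" "0 \<in> K" "K \<noteq> {}"
  using assms interior_subset[of K] by (auto simp: bodies0_def convex_body_def)

lemma Lp_integrand_measurable:
  assumes "K \<in> bodies0" "Q \<in> bodies0"
  shows "Lp_integrand p K Q \<in> borel_measurable (surface_area_measure K')"
proof -
  have [measurable]: "support_fun K \<in> borel_measurable borel" "support_fun Q \<in> borel_measurable borel"
    using assms by (auto intro: support_fun_measurable dest: bodies0_D)
  have "Lp_integrand p K Q \<in> borel_measurable borel"
    unfolding Lp_integrand_def by measurable
  then show ?thesis
    by (simp add: measurable_restrict_space1 cong: measurable_cong_sets)
qed

text \<open>In the non-integrable case both sides are 0 by default, since \<open>enn2real\<close>
  sends infinity to 0. The transformation rule can thus be proved for nonnegative integrals, where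
  one-sided bounds combine freely.\<close>

lemma Lp_mixed_volume_eq:
  fixes K Q :: "(real^'n) set"
  assumes "K \<in> bodies0" "Q \<in> bodies0"
  shows "Lp_mixed_volume p K Q =
    1 / real CARD('n) * enn2real (\<integral>\<^sup>+ u. ennreal (Lp_integrand p K Q u) \<partial>surface_area_measure K)"
proof -
  have "(LINT u|surface_area_measure K. Lp_integrand p K Q u) =
      enn2real (\<integral>\<^sup>+ u. ennreal (Lp_integrand p K Q u) \<partial>surface_area_measure K)"
    by (rule integral_eq_nn_integral[OF Lp_integrand_measurable[OF assms]]) (simp add: Lp_integrand_def)
  then show ?thesis
    by (simp add: Lp_mixed_volume_def Lp_integrand_def)
qed

context dual_linear_maps
begin

lemma bodies0_image: "K \<in> bodies0 \<Longrightarrow> T ` K \<in> bodies0"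
  using interior_injective_linear_image[OF linear_T bij_is_inj[OF bij_T], of K] linear_0[OF linear_T]
    convex_body_image[of K] image_eqI[of 0 T 0 "interior K"] by (simp add: bodies0_def)

lemma support_fun_image:
  assumes "norm v = 1" "compact Q" "Q \<noteq> {}"
  shows "support_fun (T ` Q) v = support_fun Q (pull_normal v) / norm (S (pull_normal v))"
proof -
  have "support_fun (T ` Q) v = (SUP x\<in>Q. inverse (norm (S (pull_normal v))) * (x \<bullet> pull_normal v))"
    by (simp add: support_fun_def image_image inner_T_pull_normal[OF assms(1)] divide_inverse_commute)
  also have "\<dots> = inverse (norm (S (pull_normal v))) * support_fun Q (pull_normal v)"
    unfolding support_fun_def
  proof (rule antisym)
    have bdd: "bdd_above ((\<lambda>x. x \<bullet> pull_normal v) ` Q)"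
      using assms by (intro bdd_above_inner_image)
    show "(SUP x\<in>Q. inverse (norm (S (pull_normal v))) * (x \<bullet> pull_normal v))
        \<le> inverse (norm (S (pull_normal v))) * (SUP x\<in>Q. x \<bullet> pull_normal v)"
      by (intro cSUP_least assms mult_left_mono cSUP_upper bdd) auto
    \<comment> \<open>By compactness the supremum is attained; the maximiser bounds the scaled
      supremum from below and also supplies the upper bound that \<open>cSUP_upper\<close>
      requires.\<close>
    obtain x where x: "x \<in> Q" "\<And>y. y \<in> Q \<Longrightarrow> y \<bullet> pull_normal v \<le> x \<bullet> pull_normal v"
      using continuous_attains_sup[OF assms(2,3) continuous_on_inner[OF continuous_on_id continuous_on_const]]
      by blast
    have "(SUP x\<in>Q. x \<bullet> pull_normal v) \<le> x \<bullet> pull_normal v"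
      using x assms by (intro cSUP_least)
    then have "inverse (norm (S (pull_normal v))) * (SUP x\<in>Q. x \<bullet> pull_normal v) \<le>
        inverse (norm (S (pull_normal v))) * (x \<bullet> pull_normal v)"
      by (rule mult_left_mono) simp
    also have "\<dots> \<le> (SUP x\<in>Q. inverse (norm (S (pull_normal v))) * (x \<bullet> pull_normal v))"
    proof (rule cSUP_upper[OF x(1)])
      show "bdd_above ((\<lambda>x. inverse (norm (S (pull_normal v))) * (x \<bullet> pull_normal v)) ` Q)"
        using x(2) by (intro bdd_aboveI2[of _ _ "inverse (norm (S (pull_normal v))) * (x \<bullet> pull_normal v)"] mult_left_mono) auto
    qed
    finally show "inverse (norm (S (pull_normal v))) * (SUP x\<in>Q. x \<bullet> pull_normal v)
        \<le> (SUP x\<in>Q. inverse (norm (S (pull_normal v))) * (x \<bullet> pull_normal v))" .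
  qed
  finally show ?thesis
    by (simp add: divide_inverse_commute)
qed

text \<open>Passing to \<open>T\<close> divides both support functions by \<open>norm (S u)\<close>.
  The integrand has degree p + (1 - p) = 1 in them, so for every \<open>p\<close> it is divided
  once, which cancels \<open>norm (S u)\<close> in the area density and leaves only the
  determinant.\<close>

lemma Lp_integral_image_le:
  assumes K: "K \<in> bodies0" and Q: "Q \<in> bodies0"
  shows "(\<integral>\<^sup>+ v. ennreal (Lp_integrand p (T ` K) (T ` Q) v) \<partial>surface_area_measure (T ` K)) \<le>
    ennreal \<bar>det (matrix T)\<bar> * (\<integral>\<^sup>+ u. ennreal (Lp_integrand p K Q u) \<partial>surface_area_measure K)"
proof -
  note [measurable] = Lp_integrand_measurable[OF K Q]
  have "continuous_on UNIV S"
    using linear_S by (simp add: linear_continuous_on linear_conv_bounded_linear)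
  then have "S \<in> borel_measurable borel"
    by (rule borel_measurable_continuous_onI)
  then have [measurable]: "S \<in> borel_measurable (surface_area_measure K)"
    by (simp add: measurable_restrict_space1 cong: measurable_cong_sets)
  have nonneg: "0 \<le> support_fun K u" "0 \<le> support_fun Q u" for u
    using bodies0_D[OF K] bodies0_D[OF Q] by (auto intro: support_fun_nonneg)
  have integrand: "Lp_integrand p (T ` K) (T ` Q) v =
      Lp_integrand p K Q (pull_normal v) / norm (S (pull_normal v))" if v: "norm v = 1" for v
  proof -
    let ?u = "pull_normal v" and ?s = "norm (S (pull_normal v))"
    have "?u \<noteq> 0"
      using norm_pull_normal[OF v] by auto
    then have "?s > 0"
      using S_nonzero by simp
    have "Lp_integrand p (T ` K) (T ` Q) v = (support_fun Q ?u / ?s) powr p * (support_fun K ?u / ?s) powr (1 - p)"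
      using bodies0_D[OF K] bodies0_D[OF Q] by (simp add: Lp_integrand_def support_fun_image[OF v])
    also have "\<dots> = Lp_integrand p K Q ?u / (?s powr p * ?s powr (1 - p))"
      using nonneg by (simp add: Lp_integrand_def powr_divide)
    also have "?s powr p * ?s powr (1 - p) = ?s"
      using \<open>?s > 0\<close> by (simp flip: powr_add)
    finally show ?thesis .
  qed
  have "(\<integral>\<^sup>+ v. ennreal (Lp_integrand p (T ` K) (T ` Q) v) \<partial>surface_area_measure (T ` K)) =
      (\<integral>\<^sup>+ v. ennreal (Lp_integrand p K Q (pull_normal v) / norm (S (pull_normal v))) \<partial>surface_area_measure (T ` K))"
    by (intro nn_integral_cong) (simp add: integrand)
  also have "\<dots> \<le> (\<integral>\<^sup>+ u. ennreal (area_density u) * ennreal (Lp_integrand p K Q u / norm (S u)) \<partial>surface_area_measure K)"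
    by (rule nn_integral_surface_area_image_le[OF bodies0_D(1)[OF K]]) measurable
  also have "\<dots> = (\<integral>\<^sup>+ u. ennreal \<bar>det (matrix T)\<bar> * ennreal (Lp_integrand p K Q u) \<partial>surface_area_measure K)"
  proof (rule nn_integral_cong)
    fix u assume "u \<in> space (surface_area_measure K)"
    then have "u \<noteq> 0"
      by auto
    then have "area_density u * (Lp_integrand p K Q u / norm (S u)) = \<bar>det (matrix T)\<bar> * Lp_integrand p K Q u"
      using S_nonzero by (simp add: area_density_def)
    then show "ennreal (area_density u) * ennreal (Lp_integrand p K Q u / norm (S u)) =
        ennreal \<bar>det (matrix T)\<bar> * ennreal (Lp_integrand p K Q u)"
      by (simp flip: ennreal_mult' ennreal_mult'')
  qed
  also have "\<dots> = ennreal \<bar>det (matrix T)\<bar> * (\<integral>\<^sup>+ u. ennreal (Lp_integrand p K Q u) \<partial>surface_area_measure K)"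
    by (rule nn_integral_cmult) measurable
  finally show ?thesis .
qed

text \<open>The duality forces \<open>S\<close> to be a right inverse of the adjoint of
  \<open>T\<close>, whose matrix is the transpose of that of \<open>T\<close>.\<close>

lemma det_T_S: "det (matrix T) * det (matrix S) = 1"
proof -
  have "x \<bullet> adjoint T (S y) = x \<bullet> y" for x y
    using adjoint_works[OF linear_T] dual by simp
  then have "adjoint T (S y) = y" for y
    by (metis vector_eq_rdot inner_commute)
  then have "adjoint T \<circ> S = id"
    by auto
  then have "matrix (adjoint T) ** matrix S = mat 1"
    by (metis matrix_compose[OF linear_S adjoint_linear[OF linear_T]] matrix_id_mat_1)
  then have "det (transpose (matrix T)) * det (matrix S) = 1"
    by (metis matrix_adjoint[OF linear_T] det_mul det_I)
  then show ?thesis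
    by simp
qed

lemma det_T_inv_T: "det (matrix T) * det (matrix (inv T)) = 1"
proof -
  have "T \<circ> inv T = id"
    by auto
  then have "matrix T ** matrix (inv T) = mat 1"
    by (metis matrix_compose[OF linear_inv_T linear_T] matrix_id_mat_1)
  then show ?thesis
    by (metis det_mul det_I)
qed

lemma Lp_mixed_volume_image:
  assumes K: "K \<in> bodies0" and Q: "Q \<in> bodies0"
  shows "Lp_mixed_volume p (T ` K) (T ` Q) = \<bar>det (matrix T)\<bar> * Lp_mixed_volume p K Q"
proof -
  interpret inv: dual_linear_maps "inv T" "inv S"
    by (rule inverse_maps)
  let ?I = "\<lambda>K Q. \<integral>\<^sup>+ u. ennreal (Lp_integrand p K Q u) \<partial>surface_area_measure K"
  have TK: "T ` K \<in> bodies0" "T ` Q \<in> bodies0"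
    using assms by (auto intro: bodies0_image)
  have inv_image: "inv T ` T ` X = X" for X
    by (simp add: image_image)
  have "\<bar>det (matrix T)\<bar> * \<bar>det (matrix (inv T))\<bar> = 1"
    by (simp add: det_T_inv_T flip: abs_mult)
  then have det: "ennreal \<bar>det (matrix T)\<bar> * ennreal \<bar>det (matrix (inv T))\<bar> = 1"
    by (simp flip: ennreal_mult')
  have "?I (T ` K) (T ` Q) = ennreal \<bar>det (matrix T)\<bar> * ?I K Q"
  proof (rule antisym)
    \<comment> \<open>The one-sided bound for \<open>inv T\<close>, applied to the image bodies,
      leads back to \<open>K\<close> and \<open>Q\<close>; multiplying by the determinant of
      \<open>T\<close> cancels that of \<open>inv T\<close>.\<close>
    have "?I K Q \<le> ennreal \<bar>det (matrix (inv T))\<bar> * ?I (T ` K) (T ` Q)"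
      using inv.Lp_integral_image_le[OF TK, of p] by (simp add: inv_image)
    then have "ennreal \<bar>det (matrix T)\<bar> * ?I K Q \<le>
        ennreal \<bar>det (matrix T)\<bar> * (ennreal \<bar>det (matrix (inv T))\<bar> * ?I (T ` K) (T ` Q))"
      by (rule mult_left_mono) simp
    then show "ennreal \<bar>det (matrix T)\<bar> * ?I K Q \<le> ?I (T ` K) (T ` Q)"
      by (simp add: det flip: mult.assoc)
  qed (rule Lp_integral_image_le[OF K Q])
  then show ?thesis
    by (simp add: Lp_mixed_volume_eq[OF TK] Lp_mixed_volume_eq[OF K Q] enn2real_mult)
qed

section \<open>Polar bodies and the geominimal functional\<close>

lemma polar_body_image: "polar_body (T ` Q) = S ` polar_body Q"
proof (intro set_eqI iffI)
  fix y assume y: "y \<in> polar_body (T ` Q)"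
  have "T x \<bullet> y = x \<bullet> inv S y" for x
    using dual[of x "inv S y"] by simp
  then have "inv S y \<in> polar_body Q"
    using y by (simp add: polar_body_def)
  then show "y \<in> S ` polar_body Q"
    by (metis S_inv_S image_eqI)
qed (auto simp: polar_body_def dual)

end

text \<open>The determinant rule for \<open>measure lebesgue\<close> is stated for sets of finite
  measure. The polar body is an intersection of closed half-spaces, and a ball of radius
  \<open>e\<close> inside \<open>Q\<close> confines it to radius \<open>1 / e\<close>.\<close>

lemma polar_body_lmeasurable:
  fixes Q :: "(real^'n) set"
  assumes "Q \<in> bodies0"
  shows "polar_body Q \<in> lmeasurable"
proof -
  have "polar_body Q = (\<Inter>x\<in>Q. {y. x \<bullet> y \<le> 1})"
    by (auto simp: polar_body_def)
  then have closed: "closed (polar_body Q)"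
    by (auto intro: closed_halfspace_le)
  obtain e where e: "e > 0" "cball 0 e \<subseteq> Q"
    using bodies0_D(3)[OF assms] mem_interior_cball by blast
  have "norm y \<le> 1 / e" if "y \<in> polar_body Q" for y
  proof (cases "y = 0")
    case False
    \<comment> \<open>The vector of length \<open>e\<close> in the direction of \<open>y\<close>;
      its inner product with \<open>y\<close> is \<open>e * norm y\<close>.\<close>
    have "(e / norm y) *\<^sub>R y \<in> Q"
      using e False by auto
    then have "((e / norm y) *\<^sub>R y) \<bullet> y \<le> 1"
      using that unfolding polar_body_def by blast
    moreover have "((e / norm y) *\<^sub>R y) \<bullet> y = e * norm y"
      using False by (simp add: dot_square_norm power2_eq_square)
    ultimately show ?thesis
      using e(1) by (simp add: field_simps)
  qed (use e in simp)
  then have "bounded (polar_body Q)"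
    by (auto simp: bounded_iff)
  then show ?thesis
    using closed by (intro lmeasurable_compact) (simp add: compact_eq_bounded_closed)
qed

lemma Lp_mixed_volume_nonneg: "0 \<le> Lp_mixed_volume p K Q"
  unfolding Lp_mixed_volume_def by (intro mult_nonneg_nonneg integral_nonneg_AE) auto

lemma (in dual_linear_maps) geominimal_functional_image:
  assumes K: "K \<in> bodies0" and Q: "Q \<in> bodies0"
  shows "geominimal_functional p (T ` K) (T ` Q) =
    \<bar>det (matrix T)\<bar> powr ((real CARD('n) - p) / (real CARD('n) + p)) * geominimal_functional p K Q"
proof -
  let ?n = "real CARD('n)" and ?d = "\<bar>det (matrix T)\<bar>"
  have "?d > 0"
    using det_T_S by (auto simp: zero_less_abs_iff)
  have "\<bar>det (matrix S)\<bar> = inverse ?d"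
    using det_T_S by (metis abs_inverse inverse_unique)
  then have "measure lebesgue (polar_body (T ` Q)) = inverse ?d * measure lebesgue (polar_body Q)"
    using lmeasure_linear_image[OF linear_S] polar_body_lmeasurable[OF Q] by (simp add: polar_body_image)
  then have "geominimal_functional p (T ` K) (T ` Q) =
      ?n * (?d * Lp_mixed_volume p K Q) powr (?n / (?n + p)) *
        (inverse ?d * measure lebesgue (polar_body Q)) powr (p / (?n + p))"
    by (simp add: geominimal_functional_def Lp_mixed_volume_image[OF K Q])
  also have "\<dots> = (?d powr (?n / (?n + p)) * inverse ?d powr (p / (?n + p))) * geominimal_functional p K Q"
    by (simp add: geominimal_functional_def powr_mult Lp_mixed_volume_nonneg)
  also have "inverse ?d powr (p / (?n + p)) = ?d powr (- (p / (?n + p)))"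
    using powr_divide[of 1 ?d] by (simp add: powr_minus inverse_eq_divide)
  also have "?d powr (?n / (?n + p)) * ?d powr (- (p / (?n + p))) = ?d powr ((?n - p) / (?n + p))"
    by (simp add: diff_divide_distrib flip: powr_add)
  finally show ?thesis .
qed

lemma ennreal_mult_INF:
  fixes c :: ennreal
  assumes "c \<noteq> 0" "c \<noteq> top"
  shows "(INF i\<in>I. c * f i) = c * (INF i\<in>I. f i)"
  by (intro antisym ennreal_mult_INF_le assms INF_greatest mult_left_mono) (auto intro: INF_lower)

theorem proposition3p1:
  fixes K :: "(real^'n) set" and p :: real and T :: "real^'n \<Rightarrow> real^'n"
  assumes "convex_body K" and "0 \<in> interior K"
    and "p \<noteq> - real CARD('n)"
    and "linear T" and "bij T"
  shows "geominimal_surface_area p (T ` K) =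
    ennreal (\<bar>det (matrix T)\<bar> powr ((real CARD('n) - p) / (real CARD('n) + p)))
      * geominimal_surface_area p K"
proof -
  have K: "K \<in> bodies0"
    using assms(1,2) by (simp add: bodies0_def)
  have inv_T: "linear (inv T)" "bij (inv T)"
    using inj_linear_imp_inv_linear[OF assms(4)] assms(5) by (simp_all add: bij_is_inj bij_imp_bij_inv)
  \<comment> \<open>The inverse transpose of \<open>T\<close>, realised as the adjoint of the
    inverse so that the duality follows from \<open>adjoint_works\<close>.\<close>
  define S where "S = adjoint (inv T)"
  have dual: "T x \<bullet> S y = x \<bullet> y" for x y
    using assms(5) by (simp add: S_def adjoint_works[OF inv_T(1)] bij_is_inj)
  have linS: "linear S"
    unfolding S_def by (rule adjoint_linear[OF inv_T(1)])
  have "inj S"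
  proof (rule linear_injective_0[OF linS, THEN iffD2], intro allI impI)
    fix y assume "S y = 0"
    then show "y = 0"
      using dual[of y y] by simp
  qed
  then have "bij S"
    using linear_injective_imp_surjective[OF linS] by (simp add: bij_def)
  interpret dual_linear_maps T S
    by (rule dual_linear_maps.intro) (use assms linS \<open>bij S\<close> dual in auto)
  interpret inv: dual_linear_maps "inv T" "inv S"
    by (rule inverse_maps)
  define c where "c = \<bar>det (matrix T)\<bar> powr ((real CARD('n) - p) / (real CARD('n) + p))"
  have "c > 0"
    using det_T_S by (auto simp: c_def)
  have "(\<lambda>Q. T ` Q) ` bodies0 = (bodies0 :: (real^'n) set set)"
  proof (intro set_eqI iffI)
    fix Q :: "(real^'n) set" assume "Q \<in> bodies0"
    then have "inv T ` Q \<in> bodies0" "Q = T ` inv T ` Q"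
      by (auto intro: inv.bodies0_image simp: image_image)
    then show "Q \<in> (\<lambda>Q. T ` Q) ` bodies0"
      by blast
  qed (auto intro: bodies0_image)
  \<comment> \<open>Infimum and supremum depend only on the set of values of the functional, so a
    single equation between sets of values serves both signs of \<open>p\<close>.\<close>
  then have reindex: "(\<lambda>Q. ennreal (geominimal_functional p (T ` K) Q)) ` bodies0 =
      (\<lambda>Q. ennreal (geominimal_functional p (T ` K) (T ` Q))) ` bodies0"
    by (metis (no_types, lifting) image_cong image_image)
  also have "\<dots> = (\<lambda>Q. ennreal c * ennreal (geominimal_functional p K Q)) ` bodies0"
    using \<open>c > 0\<close> by (intro image_cong refl) (simp add: geominimal_functional_image[OF K] c_def ennreal_mult')
  finally show ?thesis
    unfolding geominimal_surface_area_def c_def[symmetric] using \<open>c > 0\<close>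
    by (simp add: ennreal_mult_INF SUP_mult_left_ennreal)
qed

end
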